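(* Let $\bm{Y}_1,\dots,\bm{Y}_n$ be independent random vectors with $\bm{Y}_i\sim\mathcal{N}_q(\bm{\mu}_i(\bm{\theta}),\bm{\Sigma}_i(\bm{\theta}))$, where $\bm{\theta}=(\theta_1,\dots,\theta_p)^{\top}$ ranges over an open subset of $\mathbb{R}^p$, the entries of $\bm{\mu}_i(\bm{\theta})\in\mathbb{R}^q$ and of the nonsingular $q\times q$ covariance matrix $\bm{\Sigma}_i(\bm{\theta})$ are three times continuously differentiable in $\bm{\theta}$ (the mean and the covariance may depend on the same parameters), and the Fisher information matrix $\bm{K}_{\bm{\theta}}$ is nonsingular. Then the $n^{-1}$ bias vector $\bm{B}(\widehat{\bm{\theta}})$ of the maximum likelihood estimator $\widehat{\bm{\theta}}$ (the vector given by the Cox--Snell formula recalled in the context) is $$\bm{B}(\widehat{\bm{\theta}})=(\widetilde{\bm{F}}^{\top}\widetilde{\bm{H}}\widetilde{\bm{F}})^{-1}\widetilde{\bm{F}}^{\top}\widetilde{\bm{H}}\,\widetilde{\bm{\xi}},\qquad \widetilde{\bm{\xi}}=(\bm{\Phi}_1,\dots,\bm{\Phi}_p)\,\mathrm{vec}\bigl((\widetilde{\bm{F}}^{\top}\widetilde{\bm{H}}\widetilde{\bm{F}})^{-1}\bigr),$$ where the matrices $\widetilde{\bm{F}},\widetilde{\bm{H}},\bm{\Phi}_1,\dots,\bm{\Phi}_p$ are as defined in the context.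
   Context: Notation. $\mathrm{vec}(\cdot)$ stacks the columns of a matrix one underneath the other, $\otimes$ is the Kronecker product, and $\bm{I}_m$ is the $m\times m$ identity matrix. Put $\bm{Y}=\mathrm{vec}(\bm{Y}_1,\dots,\bm{Y}_n)\in\mathbb{R}^{nq}$, $\bm{\mu}=\mathrm{vec}(\bm{\mu}_1(\bm{\theta}),\dots,\bm{\mu}_n(\bm{\theta}))\in\mathbb{R}^{nq}$, $\bm{\Sigma}=\mathrm{diag}\{\bm{\Sigma}_1(\bm{\theta}),\dots,\bm{\Sigma}_n(\bm{\theta})\}$ (block diagonal, $nq\times nq$), and $\bm{u}=\bm{Y}-\bm{\mu}$. Up to an additive constant the log-likelihood is $$\ell(\bm{\theta})=-\tfrac12\log|\bm{\Sigma}|-\tfrac12\,\mathrm{tr}\{\bm{\Sigma}^{-1}\bm{u}\bm{u}^{\top}\}.$$ Likelihood cumulants and the $n^{-1}$ bias. For $r,s,t\in\{1,\dots,p\}$ let $U_r=\partial\ell/\partial\theta_r$, $U_{sr}=\partial^2\ell/\partial\theta_s\partial\theta_r$, $U_{tsr}=\partial^3\ell/\partial\theta_t\partial\theta_s\partial\theta_r$, and, with expectations taken under the model with parameter $\bm{\theta}$, $\kappa_{s,r}=\mathbb{E}(U_sU_r)$, $\kappa_{tsr}=\mathbb{E}(U_{tsr})$, $\kappa_{ts,r}=\mathbb{E}(U_{ts}U_r)$. The information matrix is $\bm{K}_{\bm{\theta}}=(\kappa_{s,r})_{s,r=1}^p$, assumed nonsingular, and $\kappa^{s,r}$ denotes the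 $(s,r)$ element of $\bm{K}_{\bm{\theta}}^{-1}$. The $n^{-1}$ (second-order) bias vector $\bm{B}(\widehat{\bm{\theta}})=(B(\widehat\theta_1),\dots,B(\widehat\theta_p))^{\top}$ is by definition the quantity given by the Cox--Snell formula $$B(\widehat\theta_a)=\sum_{t,s,r=1}^{p}\kappa^{a,t}\kappa^{s,r}\Bigl\{\tfrac12\kappa_{tsr}+\kappa_{ts,r}\Bigr\},\qquad a=1,\dots,p.$$ Matrices in the statement. For $r,s\in\{1,\dots,p\}$ let $$\bm{a}_r=\frac{\partial\bm{\mu}}{\partial\theta_r},\quad \bm{a}_{sr}=\frac{\partial^2\bm{\mu}}{\partial\theta_s\partial\theta_r},\quad \bm{C}_r=\frac{\partial\bm{\Sigma}}{\partial\theta_r},\quad \bm{C}_{sr}=\frac{\partial^2\bm{\Sigma}}{\partial\theta_s\partial\theta_r}.$$ Let $\widetilde{\bm{D}}=(\bm{a}_1,\dots,\bm{a}_p)$ (size $nq\times p$), $\widetilde{\bm{V}}=(\mathrm{vec}(\bm{C}_1),\dots,\mathrm{vec}(\bm{C}_p))$ (size $(nq)^2\times p$), $\widetilde{\bm{\Sigma}}=\bm{\Sigma}\otimes\bm{\Sigma}$, and $$\widetilde{\bm{F}}=\begin{pmatrix}\widetilde{\bm{D}}\\ \widetilde{\bm{V}}\end{pmatrix},\qquad \widetilde{\bm{H}}=\begin{pmatrix}\bm{\Sigma}&\bm{0}\\ \bm{0}&2\widetilde{\bm{\Sigma}}\end{pmatrix}^{-1}.$$ For $r=1,\dots,p$ let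 $\bm{\Phi}_r=-\tfrac12(\bm{G}_r+\bm{J}_r)$, where $$\bm{G}_r=\begin{bmatrix}\bm{a}_{1r}&\cdots&\bm{a}_{pr}\\ \mathrm{vec}(\bm{C}_{1r})&\cdots&\mathrm{vec}(\bm{C}_{pr})\end{bmatrix},\qquad \bm{J}_r=\begin{bmatrix}\bm{0}\\ 2(\bm{I}_{nq}\otimes\bm{a}_r)\widetilde{\bm{D}}\end{bmatrix}$$ are $(nq+(nq)^2)\times p$ matrices, so $(\bm{\Phi}_1,\dots,\bm{\Phi}_p)$ has $p^2$ columns. *)

theory Defs
  imports "HOL-Probability.Probability"
begin

section \<open>Partial derivatives and classes of differentiability\<close>

definition partial_deriv ::
  "'p::finite \<Rightarrow> (real^'p \<Rightarrow> 'b::real_normed_vector) \<Rightarrow> real^'p \<Rightarrow> 'b"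
  where "partial_deriv r f \<theta> = vector_derivative (\<lambda>t. f (\<theta> + t *\<^sub>R axis r 1)) (at 0)"

text \<open>On an open set, \<^term>\<open>continuously_diff k f S\<close> says that \<^term>\<open>f\<close> is of class
  \<open>C\<^sup>k\<close> on \<^term>\<open>S\<close>.\<close>

primrec continuously_diff ::
  "nat \<Rightarrow> (real^'p::finite \<Rightarrow> real) \<Rightarrow> (real^'p) set \<Rightarrow> bool"
  where
    "continuously_diff 0 f S \<longleftrightarrow> continuous_on S f"
  | "continuously_diff (Suc k) f S \<longleftrightarrow>
       (\<forall>x\<in>S. f differentiable (at x)) \<and> (\<forall>r. continuously_diff k (partial_deriv r f) S)"

section \<open>Nonsingular multivariate normal distributions\<close>

definition covariance_matrix :: "real^'q^'q::finite \<Rightarrow> bool"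
  where "covariance_matrix S \<longleftrightarrow> transpose S = S \<and> (\<forall>x. 0 \<le> x \<bullet> (S *v x))"

definition mvn_density :: "real^'q \<Rightarrow> real^'q^'q \<Rightarrow> real^'q::finite \<Rightarrow> real"
  where "mvn_density m S x =
    exp (- ((x - m) \<bullet> (matrix_inv S *v (x - m))) / 2) / sqrt ((2 * pi) ^ CARD('q) * det S)"

section \<open>Stacking, vectorisation and Kronecker products\<close>

text \<open>Indices of stacked objects are pairs, to be read in lexicographic order: the index
  \<open>(i, j)\<close> stands for component \<open>j\<close> of block \<open>i\<close>.  In particular the entry of a
  vectorised matrix at \<open>(j, i)\<close> is the one in column \<open>j\<close> and row \<open>i\<close>.\<close>

definition stack_vec :: "('n::finite \<Rightarrow> real^'q::finite) \<Rightarrow> real^('n \<times> 'q)"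
  where "stack_vec v = (\<chi> k. v (fst k) $ snd k)"

definition block_diag :: "('n::finite \<Rightarrow> real^'q^'q::finite) \<Rightarrow> real^('n \<times> 'q)^('n \<times> 'q)"
  where "block_diag A = (\<chi> k l. if fst k = fst l then A (fst k) $ snd k $ snd l else 0)"

definition vec_cols :: "real^'b::finite^'a::finite \<Rightarrow> real^('b \<times> 'a)"
  where "vec_cols A = (\<chi> k. A $ snd k $ fst k)"

definition of_cols :: "('b::finite \<Rightarrow> real^'a::finite) \<Rightarrow> real^'b^'a"
  where "of_cols c = (\<chi> i j. c j $ i)"

definition outer :: "real^'a::finite \<Rightarrow> real^'b::finite \<Rightarrow> real^'b^'a"
  where "outer u v = (\<chi> i j. u $ i * v $ j)"

definition kron :: "real^'b::finite^'a::finite \<Rightarrow> real^'d::finite^'c::finite \<Rightarrow>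
    real^('b \<times> 'd)^('a \<times> 'c)"
  where "kron A B = (\<chi> i j. A $ fst i $ fst j * B $ snd i $ snd j)"

text \<open>Kronecker product with a column vector, whose single column index is dropped.\<close>

definition kron_vec :: "real^'b::finite^'a::finite \<Rightarrow> real^'c::finite \<Rightarrow> real^'b^('a \<times> 'c)"
  where "kron_vec A v = (\<chi> i j. A $ fst i $ j * v $ snd i)"

definition append_vec :: "real^'a::finite \<Rightarrow> real^'b::finite \<Rightarrow> real^('a + 'b)"
  where "append_vec u v = (\<chi> k. case k of Inl i \<Rightarrow> u $ i | Inr i \<Rightarrow> v $ i)"

definition append_rows :: "real^'c::finite^'a::finite \<Rightarrow> real^'c^'b::finite \<Rightarrow> real^'c^('a + 'b)"
  where "append_rows A B = (\<chi> k. case k of Inl i \<Rightarrow> A $ i | Inr i \<Rightarrow> B $ i)"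

definition block_diag2 :: "real^'a^'a::finite \<Rightarrow> real^'b^'b::finite \<Rightarrow> real^('a + 'b)^('a + 'b)"
  where "block_diag2 A B =
    (\<chi> k. case k of Inl i \<Rightarrow> append_vec (A $ i) 0 | Inr i \<Rightarrow> append_vec 0 (B $ i))"

definition concat_cols :: "('s::finite \<Rightarrow> real^'b::finite^'a::finite) \<Rightarrow> real^('s \<times> 'b)^'a"
  where "concat_cols A = (\<chi> i k. A (fst k) $ i $ snd k)"

section \<open>Likelihood cumulants and the Cox--Snell bias\<close>

text \<open>In the sequel \<open>m\<close> and \<open>S\<close> are the stacked mean and the block-diagonal covariance
  matrix as functions of the parameter, \<open>y\<close> is a stacked observation, and \<open>P \<theta>\<close> is
  the probability measure of the model with parameter \<open>\<theta>\<close>.\<close>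

definition loglik ::
  "(real^'p::finite \<Rightarrow> real^'m::finite) \<Rightarrow> (real^'p \<Rightarrow> real^'m^'m) \<Rightarrow> real^'m \<Rightarrow> real^'p \<Rightarrow> real"
  where "loglik m S y \<theta> =
    - (1/2) * ln (det (S \<theta>))
    - (1/2) * trace (matrix_inv (S \<theta>) ** outer (y - m \<theta>) (y - m \<theta>))"

definition U1 ::
  "(real^'p::finite \<Rightarrow> real^'m::finite) \<Rightarrow> (real^'p \<Rightarrow> real^'m^'m) \<Rightarrow> 'p \<Rightarrow> real^'m \<Rightarrow> real^'p \<Rightarrow> real"
  where "U1 m S r y = partial_deriv r (loglik m S y)"

definition U2 ::
  "(real^'p::finite \<Rightarrow> real^'m::finite) \<Rightarrow> (real^'p \<Rightarrow> real^'m^'m) \<Rightarrow> 'p \<Rightarrow> 'p \<Rightarrow>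
    real^'m \<Rightarrow> real^'p \<Rightarrow> real"
  where "U2 m S s r y = partial_deriv s (partial_deriv r (loglik m S y))"

definition U3 ::
  "(real^'p::finite \<Rightarrow> real^'m::finite) \<Rightarrow> (real^'p \<Rightarrow> real^'m^'m) \<Rightarrow> 'p \<Rightarrow> 'p \<Rightarrow> 'p \<Rightarrow>
    real^'m \<Rightarrow> real^'p \<Rightarrow> real"
  where "U3 m S t s r y = partial_deriv t (partial_deriv s (partial_deriv r (loglik m S y)))"

definition fisher_information ::
  "(real^'p::finite \<Rightarrow> 'w measure) \<Rightarrow> ('w \<Rightarrow> real^'m::finite) \<Rightarrow>
    (real^'p \<Rightarrow> real^'m) \<Rightarrow> (real^'p \<Rightarrow> real^'m^'m) \<Rightarrow> real^'p \<Rightarrow> real^'p^'p"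
  where "fisher_information P Y m S \<theta> =
    (\<chi> s r. \<integral>\<omega>. U1 m S s (Y \<omega>) \<theta> * U1 m S r (Y \<omega>) \<theta> \<partial>P \<theta>)"

definition kappa3 ::
  "(real^'p::finite \<Rightarrow> 'w measure) \<Rightarrow> ('w \<Rightarrow> real^'m::finite) \<Rightarrow>
    (real^'p \<Rightarrow> real^'m) \<Rightarrow> (real^'p \<Rightarrow> real^'m^'m) \<Rightarrow> real^'p \<Rightarrow> 'p \<Rightarrow> 'p \<Rightarrow> 'p \<Rightarrow> real"
  where "kappa3 P Y m S \<theta> t s r = (\<integral>\<omega>. U3 m S t s r (Y \<omega>) \<theta> \<partial>P \<theta>)"

definition kappa21 ::
  "(real^'p::finite \<Rightarrow> 'w measure) \<Rightarrow> ('w \<Rightarrow> real^'m::finite) \<Rightarrow>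
    (real^'p \<Rightarrow> real^'m) \<Rightarrow> (real^'p \<Rightarrow> real^'m^'m) \<Rightarrow> real^'p \<Rightarrow> 'p \<Rightarrow> 'p \<Rightarrow> 'p \<Rightarrow> real"
  where "kappa21 P Y m S \<theta> t s r = (\<integral>\<omega>. U2 m S t s (Y \<omega>) \<theta> * U1 m S r (Y \<omega>) \<theta> \<partial>P \<theta>)"

definition cox_snell_bias ::
  "(real^'p::finite \<Rightarrow> 'w measure) \<Rightarrow> ('w \<Rightarrow> real^'m::finite) \<Rightarrow>
    (real^'p \<Rightarrow> real^'m) \<Rightarrow> (real^'p \<Rightarrow> real^'m^'m) \<Rightarrow> real^'p \<Rightarrow> real^'p"
  where "cox_snell_bias P Y m S \<theta> =
    (let Kinv = matrix_inv (fisher_information P Y m S \<theta>) in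
     \<chi> a. \<Sum>t\<in>UNIV. \<Sum>s\<in>UNIV. \<Sum>r\<in>UNIV.
       Kinv $ a $ t * Kinv $ s $ r * (1/2 * kappa3 P Y m S \<theta> t s r + kappa21 P Y m S \<theta> t s r))"

section \<open>The matrices of the closed-form expression\<close>

definition D_mat :: "(real^'p::finite \<Rightarrow> real^'m::finite) \<Rightarrow> real^'p \<Rightarrow> real^'p^'m"
  where "D_mat m \<theta> = of_cols (\<lambda>r. partial_deriv r m \<theta>)"

definition V_mat :: "(real^'p::finite \<Rightarrow> real^'m^'m::finite) \<Rightarrow> real^'p \<Rightarrow> real^'p^('m \<times> 'm)"
  where "V_mat S \<theta> = of_cols (\<lambda>r. vec_cols (partial_deriv r S \<theta>))"

definition F_mat ::
  "(real^'p::finite \<Rightarrow> real^'m::finite) \<Rightarrow> (real^'p \<Rightarrow> real^'m^'m) \<Rightarrow> real^'p \<Rightarrow> real^'p^('m + 'm \<times> 'm)"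
  where "F_mat m S \<theta> = append_rows (D_mat m \<theta>) (V_mat S \<theta>)"

definition H_mat ::
  "(real^'p::finite \<Rightarrow> real^'m^'m::finite) \<Rightarrow> real^'p \<Rightarrow> real^('m + 'm \<times> 'm)^('m + 'm \<times> 'm)"
  where "H_mat S \<theta> = matrix_inv (block_diag2 (S \<theta>) (2 *\<^sub>R kron (S \<theta>) (S \<theta>)))"

definition G_mat ::
  "(real^'p::finite \<Rightarrow> real^'m::finite) \<Rightarrow> (real^'p \<Rightarrow> real^'m^'m) \<Rightarrow> real^'p \<Rightarrow> 'p \<Rightarrow>
    real^'p^('m + 'm \<times> 'm)"
  where "G_mat m S \<theta> r = append_rows
    (of_cols (\<lambda>s. partial_deriv s (partial_deriv r m) \<theta>))
    (of_cols (\<lambda>s. vec_cols (partial_deriv s (partial_deriv r S) \<theta>)))"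

definition J_mat ::
  "(real^'p::finite \<Rightarrow> real^'m::finite) \<Rightarrow> real^'p \<Rightarrow> 'p \<Rightarrow> real^'p^('m + 'm \<times> 'm)"
  where "J_mat m \<theta> r = append_rows 0
    (2 *\<^sub>R (kron_vec (mat 1 :: real^'m^'m) (partial_deriv r m \<theta>) ** D_mat m \<theta>))"

definition Phi_mat ::
  "(real^'p::finite \<Rightarrow> real^'m::finite) \<Rightarrow> (real^'p \<Rightarrow> real^'m^'m) \<Rightarrow> real^'p \<Rightarrow> 'p \<Rightarrow>
    real^'p^('m + 'm \<times> 'm)"
  where "Phi_mat m S \<theta> r = (- 1/2) *\<^sub>R (G_mat m S \<theta> r + J_mat m \<theta> r)"

definition xi_vec ::
  "(real^'p::finite \<Rightarrow> real^'m::finite) \<Rightarrow> (real^'p \<Rightarrow> real^'m^'m) \<Rightarrow> real^'p \<Rightarrow> real^('m + 'm \<times> 'm)"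
  where "xi_vec m S \<theta> =
    concat_cols (Phi_mat m S \<theta>) *v
      vec_cols (matrix_inv (transpose (F_mat m S \<theta>) ** H_mat S \<theta> ** F_mat m S \<theta>))"

end

theory Submission
  imports Defs
begin

text \<open>Write \<open>S\<close> for the covariance matrix, \<open>W\<close> for its inverse and
  \<open>u = y - m\<close>. The log-likelihood and all its partial derivatives have the form
  \<open>c + b \<bullet> u - (1/2) * (u \<bullet> (A *v u))\<close>, so the cumulants follow from the moments of
  \<open>u\<close> up to order four. These come from the moment generating function, which is found
  by completing the square and translating Lebesgue measure, and from polarisation.

  Since \<open>tr (W C\<^sub>r) = - tr (\<partial>\<^sub>r W \<cdot> S)\<close>, the only third-order
  derivative with nonzero mean in the third derivative of the log-likelihood,
  \<open>\<partial>\<^sub>t \<partial>\<^sub>s \<partial>\<^sub>r W\<close>, cancels in expectation. The Fisher information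
  turns out to be \<open>F\<^sup>T H F\<close>, and \<open>(1/2) * \<kappa>\<^sub>t\<^sub>s\<^sub>r + \<kappa>\<^sub>t\<^sub>s\<^sub>,\<^sub>r\<close> agrees with the entry of
  \<open>F\<^sup>T H \<Phi>\<^sub>r\<close> at \<open>(t, s)\<close> after symmetrisation in \<open>s\<close> and \<open>r\<close>, which suffices
  because both are contracted with the symmetric inverse information.\<close>

section \<open>Matrices\<close>

lemma symmetric_matrix_entry:
  fixes S :: "real^'m::finite^'m"
  assumes "transpose S = S"
  shows "S $ i $ j = S $ j $ i"
  using arg_cong[OF assms, of "\<lambda>A. A $ i $ j"] by (simp add: transpose_def)

lemma inner_symmetric_matrix:
  fixes S :: "real^'m::finite^'m"
  assumes "transpose S = S"
  shows "a \<bullet> (S *v b) = b \<bullet> (S *v a)"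
  by (metis assms dot_lmul_matrix inner_commute transpose_matrix_vector)

text \<open>Coordinates are written as inner products with \<open>axis\<close> vectors, so that
  moment formulas for products of linear forms apply to each summand.\<close>

lemma quadratic_form_axis:
  fixes A :: "real^'m::finite^'m"
  shows "u \<bullet> (A *v u) = (\<Sum>i\<in>UNIV. \<Sum>j\<in>UNIV. A $ i $ j * ((axis i 1 \<bullet> u) * (axis j 1 \<bullet> u)))"
  by (simp add: inner_vec_def[of u] matrix_vector_mult_def inner_axis' sum_distrib_left
      algebra_simps)

lemma axis_inner_matrix_axis: "axis i 1 \<bullet> (S *v axis j 1) = (S :: real^'m::finite^'m) $ i $ j"
  by (simp add: inner_axis' inner_axis matrix_vector_mul_component)

text \<open>The index order is the one in which a product of two quadratic forms expands, ready for
  comparison with fourth moments.\<close>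

lemma trace_four_products:
  fixes A B C D :: "real^'k::finite^'k"
  shows "trace (A ** B ** C ** D)
    = (\<Sum>i\<in>UNIV. \<Sum>j\<in>UNIV. \<Sum>k\<in>UNIV. \<Sum>l\<in>UNIV. A $ i $ j * B $ j $ k * C $ k $ l * D $ l $ i)"
proof -
  have "trace (A ** B ** C ** D) = trace ((A ** B) ** (C ** D))"
    by (simp add: matrix_mul_assoc)
  also have "\<dots> = (\<Sum>i\<in>UNIV. \<Sum>k\<in>UNIV. \<Sum>j\<in>UNIV. \<Sum>l\<in>UNIV.
      A $ i $ j * B $ j $ k * C $ k $ l * D $ l $ i)"
    unfolding trace_def matrix_matrix_mult_def
    by (simp add: sum_distrib_left sum_distrib_right mult_ac)
      (subst (2) sum.swap, rule refl)
  also have "\<dots> = (\<Sum>i\<in>UNIV. \<Sum>j\<in>UNIV. \<Sum>k\<in>UNIV. \<Sum>l\<in>UNIV.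
      A $ i $ j * B $ j $ k * C $ k $ l * D $ l $ i)"
    by (rule sum.cong[OF refl], rule sum.swap)
  finally show ?thesis .
qed

lemma trace_outer: "trace (B ** outer u v) = v \<bullet> (B *v u)" for B :: "real^'k::finite^'m::finite"
  by (simp add: trace_def matrix_matrix_mult_def outer_def inner_vec_def matrix_vector_mult_def
      sum_distrib_left sum_distrib_right mult_ac)

text \<open>\<open>matrix_inv\<close> is a choice operator; it has the two defining properties as
  soon as some inverse exists.\<close>

lemma matrix_inv_inverse:
  fixes A :: "real^'n::finite^'n"
  assumes "invertible A"
  shows "A ** matrix_inv A = mat 1" "matrix_inv A ** A = mat 1"
  using assms unfolding invertible_def matrix_inv_def by (metis (mono_tags, lifting) someI_ex)+

text \<open>For square matrices a right inverse is already two-sided, so one product suffices to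
  identify the inverse.\<close>

lemma matrix_inv_eqI:
  fixes A :: "real^'n::finite^'n"
  assumes "A ** B = mat 1"
  shows "matrix_inv A = B"
  by (metis assms invertible_right_inverse matrix_inv_inverse(2) matrix_mul_assoc matrix_mul_lid
      matrix_mul_rid)

lemma transpose_matrix_inv:
  fixes A :: "real^'n::finite^'n"
  assumes "invertible A"
  shows "transpose (matrix_inv A) = matrix_inv (transpose A)"
  by (metis assms matrix_inv_eqI matrix_inv_inverse(2) matrix_transpose_mul transpose_mat)

text \<open>Cramer's rule applied to column \<open>l\<close> of the inverse. Quotients of
  determinants make the differentiability of the inverse accessible.\<close>

lemma matrix_inv_cramer:
  fixes A :: "real^'n::finite^'n"
  assumes "invertible A"
  shows "matrix_inv A $ k $ l =
    det (\<chi> i j. if j = k then axis l 1 $ i else A $ i $ j) / det A"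
proof -
  have "A *v (matrix_inv A *v axis l 1) = axis l 1"
    by (simp add: matrix_vector_mul_assoc matrix_inv_inverse assms)
  then have "matrix_inv A *v axis l 1
      = (\<chi> k. det (\<chi> i j. if j = k then axis l 1 $ i else A $ i $ j) / det A)"
    using assms by (intro iffD1[OF cramer]) (simp_all add: invertible_det_nz)
  moreover have "(matrix_inv A *v axis l 1) $ k = matrix_inv A $ k $ l"
    by (simp add: matrix_vector_mul_component inner_axis)
  ultimately show ?thesis by simp
qed

lemma bounded_bilinear_matrix_mult:
  "bounded_bilinear ((**) :: real^'b::finite^'a::finite \<Rightarrow> real^'c::finite^'b \<Rightarrow> real^'c^'a)"
  unfolding bilinear_conv_bounded_bilinear[symmetric] bilinear_def linear_iff
  by (simp add: vec_eq_iff matrix_matrix_mult_def sum.distrib algebra_simps sum_distrib_left)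

lemmas matrix_mult_add_left = bounded_bilinear.add_left[OF bounded_bilinear_matrix_mult]
lemmas matrix_mult_diff_left = bounded_bilinear.diff_left[OF bounded_bilinear_matrix_mult]
lemmas matrix_mult_minus_left = bounded_bilinear.minus_left[OF bounded_bilinear_matrix_mult]
lemmas matrix_mult_minus_right = bounded_bilinear.minus_right[OF bounded_bilinear_matrix_mult]

lemma bounded_bilinear_matrix_vector_mult:
  "bounded_bilinear ((*v) :: real^'b::finite^'a::finite \<Rightarrow> real^'b \<Rightarrow> real^'a)"
  unfolding bilinear_conv_bounded_bilinear[symmetric] bilinear_def linear_iff
  by (simp add: vec_eq_iff matrix_vector_mult_def sum.distrib algebra_simps sum_distrib_left)

lemma bounded_linear_trace: "bounded_linear (trace :: real^'a::finite^'a \<Rightarrow> real)"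
  unfolding linear_conv_bounded_linear[symmetric] linear_iff
  by (simp add: trace_def sum.distrib sum_distrib_left)

section \<open>Block matrices, vectorisation and Kronecker products\<close>

lemma inner_stack:
  fixes w :: "real^('n::finite \<times> 'q::finite)"
  shows "w \<bullet> v = (\<Sum>i\<in>UNIV. (\<chi> j. w $ (i, j)) \<bullet> (\<chi> j. v $ (i, j)))"
  by (simp add: inner_vec_def sum.cartesian_product flip: UNIV_Times_UNIV)

lemma block_diag_mult_vec:
  "block_diag A *v w = stack_vec (\<lambda>i. A i *v (\<chi> j. w $ (i, j)))"
  by (simp add: vec_eq_iff block_diag_def stack_vec_def matrix_vector_mult_def if_distrib
      if_distribR sum.cartesian_product' sum.If_cases cong: if_cong
      flip: UNIV_Times_UNIV)

lemma transpose_block_diag: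
  "(\<And>i. transpose (A i) = A i) \<Longrightarrow> transpose (block_diag A) = block_diag A"
  by (auto simp: transpose_def block_diag_def vec_eq_iff)

lemma invertible_block_diag:
  fixes A :: "'n::finite \<Rightarrow> real^'q^'q::finite"
  assumes "\<And>i. invertible (A i)"
  shows "invertible (block_diag A)"
proof -
  have "block_diag A ** block_diag (\<lambda>i. matrix_inv (A i)) = mat 1"
    unfolding matrix_eq matrix_vector_mul_assoc[symmetric] block_diag_mult_vec
    by (auto simp: vec_eq_iff stack_vec_def matrix_vector_mul_assoc matrix_inv_inverse assms)
  then show ?thesis using invertible_right_inverse by blast
qed

lemma append_vec_inner: "append_vec a b \<bullet> append_vec c d = a \<bullet> c + b \<bullet> d"
  by (simp add: inner_vec_def append_vec_def UNIV_Plus_UNIV[symmetric] sum.Plus del: UNIV_Plus_UNIV)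

lemma block_diag2_mult_append_vec:
  "block_diag2 A B *v append_vec a b = append_vec (A *v a) (B *v b)"
  by (auto simp: vec_eq_iff block_diag2_def append_vec_def matrix_vector_mult_def
      UNIV_Plus_UNIV[symmetric] sum.Plus simp del: UNIV_Plus_UNIV split: sum.split)

text \<open>Lets a matrix identity be checked on stacked vectors whose lower part is a vectorised
  matrix, where Kronecker products act by \<open>kron_mult_vec_cols\<close>.\<close>

lemma append_vec_cases:
  obtains a X where "v = append_vec a (vec_cols X)"
proof
  show "v = append_vec (\<chi> i. v $ Inl i) (vec_cols (\<chi> i j. v $ Inr (j, i)))"
    by (auto simp: vec_eq_iff append_vec_def vec_cols_def split: sum.split)
qed

text \<open>The standard vec-Kronecker identity. No permutation of indices occurs because
  \<open>vec_cols\<close> puts the column index first, in line with the first factor of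
  \<open>kron\<close>.\<close>

lemma kron_mult_vec_cols: "kron A B *v vec_cols X = vec_cols (B ** X ** transpose A)"
proof -
  have "(kron A B *v vec_cols X) $ (i, j) = vec_cols (B ** X ** transpose A) $ (i, j)" for i j
  proof -
    have "(kron A B *v vec_cols X) $ (i, j)
        = (\<Sum>k\<in>UNIV. \<Sum>l\<in>UNIV. A $ i $ k * B $ j $ l * X $ l $ k)"
      by (simp add: kron_def vec_cols_def matrix_vector_mult_def sum.cartesian_product'
          flip: UNIV_Times_UNIV)
    also have "\<dots> = vec_cols (B ** X ** transpose A) $ (i, j)"
      by (simp add: vec_cols_def matrix_matrix_mult_def transpose_def sum_distrib_left
          sum_distrib_right mult_ac)
    finally show ?thesis .
  qed
  then show ?thesis by (simp add: vec_eq_iff)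
qed

lemma vec_cols_inner: "vec_cols X \<bullet> vec_cols Y = trace (transpose X ** Y)"
  by (simp add: vec_cols_def inner_vec_def trace_def transpose_def matrix_matrix_mult_def
      sum.cartesian_product' flip: UNIV_Times_UNIV)

lemma of_cols_congruence_entry:
  fixes H :: "real^'a::finite^'a"
  shows "(transpose (of_cols f) ** H ** of_cols g) $ s $ r = f s \<bullet> (H *v g r)"
  unfolding matrix_mul_assoc[symmetric]
  by (simp add: matrix_matrix_mult_def transpose_def of_cols_def inner_vec_def
      matrix_vector_mult_def sum_distrib_left)

lemma transpose_of_cols_mult: "transpose (of_cols f) *v v = (\<chi> t. f t \<bullet> v)"
  by (simp add: vec_eq_iff transpose_def of_cols_def matrix_vector_mult_def inner_vec_def)

text \<open>Both pair indices are ordered alike: column \<open>s\<close> of block \<open>r\<close>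
  meets the entry of \<open>M\<close> in column \<open>r\<close> and row \<open>s\<close>.\<close>

lemma concat_cols_mult_vec_cols:
  fixes f :: "'r::finite \<Rightarrow> 's::finite \<Rightarrow> real^'a::finite"
  assumes "\<And>r. A r = of_cols (f r)"
  shows "concat_cols A *v vec_cols M = (\<Sum>r\<in>UNIV. \<Sum>s\<in>UNIV. M $ s $ r *\<^sub>R f r s)"
  by (simp add: vec_eq_iff assms concat_cols_def vec_cols_def of_cols_def matrix_vector_mult_def
      sum.cartesian_product' sum_component mult.commute flip: UNIV_Times_UNIV)

text \<open>Symmetric weights see only the symmetric part of the summand: exchanging the two
  summation indices doubles the sum into one over \<open>h s r + h r s\<close>.\<close>

lemma sum_symmetric_weights:
  fixes k :: "real^'p::finite^'p"
  assumes "transpose k = k"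
    and "\<And>s r. f s r + f r s = g s r + (g r s :: real)"
  shows "(\<Sum>s\<in>UNIV. \<Sum>r\<in>UNIV. k $ s $ r * f s r) = (\<Sum>s\<in>UNIV. \<Sum>r\<in>UNIV. k $ s $ r * g s r)"
proof -
  have k: "k $ r $ s = k $ s $ r" for r s
    by (rule symmetric_matrix_entry[OF assms(1)])
  have swap: "(\<Sum>s\<in>UNIV. \<Sum>r\<in>UNIV. k $ s $ r * h s r) = (\<Sum>s\<in>UNIV. \<Sum>r\<in>UNIV. k $ s $ r * h r s)"
    for h by (subst sum.swap) (simp add: k)
  have "2 * (\<Sum>s\<in>UNIV. \<Sum>r\<in>UNIV. k $ s $ r * h s r)
      = (\<Sum>s\<in>UNIV. \<Sum>r\<in>UNIV. k $ s $ r * (h s r + h r s))" for h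
    using swap[of h] by (simp add: distrib_left sum.distrib)
  from this[of f] this[of g] show ?thesis by (simp add: assms(2))
qed

section \<open>Moments of Gaussian vectors\<close>

text \<open>The value at 0 gives the constant coefficient. The termwise derivative again sums to 0
  and shifts the coefficients down by one, up to a nonzero factor, so induction over all coefficient
  sequences applies.\<close>

lemma powser_eq_0_coeff:
  fixes d :: "nat \<Rightarrow> real"
  assumes "\<And>t. (\<lambda>k. d k * t ^ k) sums 0"
  shows "d n = 0"
  using assms
proof (induction n arbitrary: d)
  case 0
  then show ?case using powser_sums_zero_iff by blast
next
  case (Suc n)
  have "(\<lambda>k. diffs d k * t ^ k) sums 0" for t
  proof -
    have "((\<lambda>x. \<Sum>n. d n * x ^ n) has_real_derivative (\<Sum>n. diffs d n * t ^ n)) (at t)"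
      using Suc.prems by (intro termdiffs_strong_converges_everywhere) (rule sums_summable)
    moreover have "(\<lambda>x. \<Sum>n. d n * x ^ n) = (\<lambda>x. 0)"
      using Suc.prems by (simp add: sums_iff)
    ultimately have "(\<Sum>n. diffs d n * t ^ n) = 0"
      by (metis DERIV_const DERIV_unique)
    moreover have "summable (\<lambda>n. diffs d n * t ^ n)"
      using Suc.prems by (intro termdiff_converges_all) (rule sums_summable)
    ultimately show ?thesis by (simp add: sums_iff)
  qed
  then have "diffs d n = 0" by (rule Suc.IH)
  then show ?case by (simp add: diffs_def)
qed

lemma has_bochner_integral_nn_integral_exp:
  assumes "X \<in> borel_measurable M"
    and "(\<integral>\<^sup>+\<omega>. ennreal (exp (X \<omega>)) \<partial>M) = ennreal (exp s)"
  shows "has_bochner_integral M (\<lambda>\<omega>. exp (X \<omega>)) (exp s)"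
  using assms by (intro has_bochner_integral_nn_integral) auto

text \<open>The moment generating function is expanded in powers of \<open>t\<close> under the
  expectation and compared, coefficient by coefficient, with the series of
  \<open>exp (t\<^sup>2 * s / 2)\<close>.\<close>

lemma (in prob_space) moments_of_gaussian_mgf:
  fixes X :: "'a \<Rightarrow> real"
  assumes X [measurable]: "random_variable borel X"
    and mgf: "\<And>t. (\<integral>\<^sup>+\<omega>. ennreal (exp (t * X \<omega>)) \<partial>M) = ennreal (exp (t\<^sup>2 * s / 2))"
  shows "has_bochner_integral M (\<lambda>\<omega>. X \<omega> ^ k)
    (if even k then fact k * (s / 2) ^ (k div 2) / fact (k div 2) else 0)"
proof -
  have E: "has_bochner_integral M (\<lambda>\<omega>. exp (t * X \<omega>)) (exp (t\<^sup>2 * s / 2))" for t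
    using mgf[of t] by (intro has_bochner_integral_nn_integral_exp) auto
  then have E_int: "integrable M (\<lambda>\<omega>. exp (t * X \<omega>))" for t
    using has_bochner_integral_iff by blast
  have bound: "exp \<bar>x\<bar> \<le> exp x + exp (- x)" for x :: real
    by (cases "x \<ge> 0") auto
  have exp_sums: "(\<lambda>i. (t * x) ^ i / fact i) sums exp (t * x)" for t x :: real
    using exp_converges[of "t * x"] by (simp add: divide_inverse mult.commute)
  \<comment> \<open>This bound serves twice: it dominates each single power, giving integrability,
    and it bounds all partial sums uniformly, giving termwise integration.\<close>
  have partial: "(\<Sum>i<n. \<bar>t * x\<bar> ^ i / fact i) \<le> exp (t * x) + exp (- (t * x))"
    for n and t x :: real
  proof -
    have "(\<Sum>i<n. \<bar>t * x\<bar> ^ i / fact i) \<le> (\<Sum>i. \<bar>t * x\<bar> ^ i / fact i)"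
      using exp_sums[of 1 "\<bar>t * x\<bar>"] by (intro sum_le_suminf) (auto simp: sums_iff)
    also have "\<dots> = exp \<bar>t * x\<bar>"
      using exp_sums[of 1 "\<bar>t * x\<bar>"] by (simp add: sums_iff)
    finally show ?thesis using bound[of "t * x"] by linarith
  qed
  have term_le: "\<bar>t * x\<bar> ^ i / fact i \<le> exp (t * x) + exp (- (t * x))"
    for i and t x :: real
  proof -
    have "\<bar>t * x\<bar> ^ i / fact i \<le> (\<Sum>i<Suc i. \<bar>t * x\<bar> ^ i / fact i)"
      by (rule member_le_sum) auto
    then show ?thesis using partial[of t x "Suc i"] by linarith
  qed
  have dom: "integrable M (\<lambda>\<omega>. exp (t * X \<omega>) + exp (- (t * X \<omega>)))" for t
    using E_int[of t] E_int[of "- t"] by auto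
  have term_int: "integrable M (\<lambda>\<omega>. (t * X \<omega>) ^ i / fact i)" for t i
    by (rule Bochner_Integration.integrable_bound[OF dom[of t]])
      (use term_le[of t _ i] in \<open>auto simp: power_abs abs_mult\<close>)
  have abs_int: "integrable M (\<lambda>\<omega>. \<bar>t * X \<omega>\<bar> ^ i / fact i)" for t i
    using integrable_norm[OF term_int[of t i]] by (simp add: power_abs)
  have pow_int: "integrable M (\<lambda>\<omega>. X \<omega> ^ i)" for i
    using integrable_mult_right[OF term_int[of 1 i], of "fact i"] by simp
  have "(\<lambda>i. expectation (\<lambda>\<omega>. (t * X \<omega>) ^ i / fact i)) sums
      expectation (\<lambda>\<omega>. \<Sum>i. (t * X \<omega>) ^ i / fact i)" for t
  proof (rule sums_integral)
    show "AE \<omega> in M. summable (\<lambda>i. norm ((t * X \<omega>) ^ i / fact i))"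
      using exp_sums[of 1 "\<bar>t * X _\<bar>"] by (auto simp: power_abs abs_mult sums_iff)
    show "summable (\<lambda>i. expectation (\<lambda>\<omega>. norm ((t * X \<omega>) ^ i / fact i)))"
    proof (rule summableI_nonneg_bounded)
      fix n
      have "(\<Sum>i<n. expectation (\<lambda>\<omega>. norm ((t * X \<omega>) ^ i / fact i)))
          = expectation (\<lambda>\<omega>. \<Sum>i<n. norm ((t * X \<omega>) ^ i / fact i))"
        using term_int by (intro Bochner_Integration.integral_sum[symmetric] integrable_norm)
      also have "\<dots> \<le> expectation (\<lambda>\<omega>. exp (t * X \<omega>) + exp (- (t * X \<omega>)))"
        using abs_int[of t] dom[of t] partial[of t]
        by (intro integral_mono Bochner_Integration.integrable_sum) (auto simp: power_abs)
      finally show "(\<Sum>i<n. expectation (\<lambda>\<omega>. norm ((t * X \<omega>) ^ i / fact i)))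
          \<le> expectation (\<lambda>\<omega>. exp (t * X \<omega>) + exp (- (t * X \<omega>)))" .
    qed auto
  qed (rule term_int)
  moreover have "expectation (\<lambda>\<omega>. \<Sum>i. (t * X \<omega>) ^ i / fact i) = exp (t\<^sup>2 * s / 2)" for t
    using E[of t] exp_sums[of t] by (simp add: sums_iff has_bochner_integral_iff)
  ultimately have M: "(\<lambda>i. expectation (\<lambda>\<omega>. X \<omega> ^ i) / fact i * t ^ i) sums exp (t\<^sup>2 * s / 2)"
    for t
    by (simp add: power_mult_distrib mult.commute)
  \<comment> \<open>The coefficients of \<open>exp (t\<^sup>2 * s / 2)\<close> as a series in
    \<open>t\<close>; \<open>sums_if\<close> below interleaves the series in
    \<open>t\<^sup>2\<close> with zeros at the odd places.\<close>
  define c where "c i = (if even i then (s / 2) ^ (i div 2) / fact (i div 2) else 0)" for i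
  have c: "(\<lambda>i. c i * t ^ i) sums exp (t\<^sup>2 * s / 2)" for t
  proof -
    have "(\<lambda>n. if even n then (\<lambda>i. (t\<^sup>2 * (s / 2)) ^ i / fact i) (n div 2)
        else (\<lambda>_. 0) ((n - 1) div 2)) sums (0 + exp (t\<^sup>2 * (s / 2)))"
      by (rule sums_if) (use exp_sums[of "t\<^sup>2" "s / 2"] in auto)
    moreover have "(\<lambda>n. if even n then (\<lambda>i. (t\<^sup>2 * (s / 2)) ^ i / fact i) (n div 2)
        else (\<lambda>_. 0) ((n - 1) div 2)) = (\<lambda>i. c i * t ^ i)"
      by (auto simp: c_def fun_eq_iff power_mult_distrib power_divide power_mult elim!: evenE)
    ultimately show ?thesis by simp
  qed
  have "(\<lambda>i. (expectation (\<lambda>\<omega>. X \<omega> ^ i) / fact i - c i) * t ^ i) sums 0" for t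
    using sums_diff[OF M[of t] c[of t]] by (simp add: left_diff_distrib)
  then have "expectation (\<lambda>\<omega>. X \<omega> ^ k) / fact k - c k = 0"
    by (rule powser_eq_0_coeff[where d = "\<lambda>i. expectation (\<lambda>\<omega>. X \<omega> ^ i) / fact i - c i"])
  then have "expectation (\<lambda>\<omega>. X \<omega> ^ k) = fact k * c k"
    by (simp add: field_simps)
  then show ?thesis
    using pow_int[of k] by (auto simp: has_bochner_integral_iff c_def)
qed

section \<open>Centred Gaussian vectors and their moments up to order four\<close>

text \<open>Characterised by the moment generating function instead of a density, because this form
  passes to stacked independent vectors by multiplication. The nonnegative integral makes sense
  before any integrability is known.\<close>

definition centred_gaussian :: "'w measure \<Rightarrow> ('w \<Rightarrow> real^'m::finite) \<Rightarrow> real^'m^'m \<Rightarrow> bool"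
  where "centred_gaussian M u S \<longleftrightarrow> prob_space M \<and> u \<in> borel_measurable M \<and> transpose S = S \<and>
    (\<forall>w. (\<integral>\<^sup>+\<omega>. ennreal (exp (w \<bullet> u \<omega>)) \<partial>M) = ennreal (exp (w \<bullet> (S *v w) / 2)))"

text \<open>On the multiples \<open>t *\<^sub>R w\<close> the generating function of the vector
  becomes that of the scalar \<open>w \<bullet> u\<close>, with variance
  \<open>w \<bullet> (S *v w)\<close>.\<close>

lemma centred_gaussian_power:
  assumes "centred_gaussian M u S"
  shows "has_bochner_integral M (\<lambda>\<omega>. (w \<bullet> u \<omega>) ^ k)
    (if even k then fact k * (w \<bullet> (S *v w) / 2) ^ (k div 2) / fact (k div 2) else 0)"
proof -
  interpret prob_space M using assms by (simp add: centred_gaussian_def)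
  have [measurable]: "u \<in> borel_measurable M" using assms by (simp add: centred_gaussian_def)
  have "(\<integral>\<^sup>+\<omega>. ennreal (exp (t * (w \<bullet> u \<omega>))) \<partial>M) = ennreal (exp (t\<^sup>2 * (w \<bullet> (S *v w)) / 2))"
    for t
  proof -
    have "(\<integral>\<^sup>+\<omega>. ennreal (exp ((t *\<^sub>R w) \<bullet> u \<omega>)) \<partial>M)
        = ennreal (exp ((t *\<^sub>R w) \<bullet> (S *v (t *\<^sub>R w)) / 2))"
      using assms unfolding centred_gaussian_def by blast
    then show ?thesis by (simp add: matrix_vector_mult_scaleR power2_eq_square mult.assoc)
  qed
  then show ?thesis by (intro moments_of_gaussian_mgf) measurable
qed

lemma has_bochner_integral_eq:
  "has_bochner_integral M f x \<Longrightarrow> (\<And>\<omega>. f \<omega> = g \<omega>) \<Longrightarrow> x = y \<Longrightarrow> has_bochner_integral M g y"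
  by (simp add: ext[of f g])

context
  fixes M :: "'w measure" and u :: "'w \<Rightarrow> real^'m::finite" and S :: "real^'m^'m"
  assumes G: "centred_gaussian M u S"
begin

lemma centred_gaussian_moment1: "has_bochner_integral M (\<lambda>\<omega>. a \<bullet> u \<omega>) 0"
  using centred_gaussian_power[OF G, of a 1] by simp

text \<open>Polarisation. With the first sign kept positive, the \<open>2^(k-1)\<close> sign choices
  in a sum of \<open>k\<close> terms, weighted by the product of the signs, combine the
  \<open>k\<close>-th powers into \<open>2^(k-1) * k!\<close> times the product of the terms. This
  gives the divisor 4 here and 24 and 192 in the next two moments.\<close>

lemma centred_gaussian_moment2:
  "has_bochner_integral M (\<lambda>\<omega>. (a \<bullet> u \<omega>) * (b \<bullet> u \<omega>)) (a \<bullet> (S *v b))"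
proof -
  have p: "has_bochner_integral M (\<lambda>\<omega>. (w \<bullet> u \<omega>)\<^sup>2) (w \<bullet> (S *v w))" for w
    using centred_gaussian_power[OF G, of w 2] by (simp add: fact_numeral)
  have "b \<bullet> (S *v a) = a \<bullet> (S *v b)"
    using G by (simp add: centred_gaussian_def inner_symmetric_matrix)
  then show ?thesis
    by (intro has_bochner_integral_eq[OF has_bochner_integral_divide_zero
        [OF has_bochner_integral_diff[OF p[of "a + b"] p[of "a - b"]], of 4]])
      (simp_all add: power2_eq_square inner_simps algebra_simps matrix_vector_right_distrib
        matrix_vector_mult_diff_distrib)
qed

lemma centred_gaussian_moment3:
  "has_bochner_integral M (\<lambda>\<omega>. (a \<bullet> u \<omega>) * (b \<bullet> u \<omega>) * (c \<bullet> u \<omega>)) 0"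
proof -
  have p: "has_bochner_integral M (\<lambda>\<omega>. (w \<bullet> u \<omega>) ^ 3) 0" for w
    using centred_gaussian_power[OF G, of w 3] by simp
  show ?thesis
    by (intro has_bochner_integral_eq[OF has_bochner_integral_divide_zero
        [OF has_bochner_integral_diff[OF
          has_bochner_integral_add[OF p[of "a + b + c"] p[of "a - b - c"]]
          has_bochner_integral_add[OF p[of "a + b - c"] p[of "a - b + c"]]], of 24]])
      (simp_all add: power3_eq_cube inner_simps algebra_simps)
qed

text \<open>Isserlis' formula for four factors: one summand for each of the three pairings.\<close>

lemma centred_gaussian_moment4:
  "has_bochner_integral M (\<lambda>\<omega>. (a \<bullet> u \<omega>) * (b \<bullet> u \<omega>) * (c \<bullet> u \<omega>) * (d \<bullet> u \<omega>))
    ((a \<bullet> (S *v b)) * (c \<bullet> (S *v d)) + (a \<bullet> (S *v c)) * (b \<bullet> (S *v d))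
      + (a \<bullet> (S *v d)) * (b \<bullet> (S *v c)))"
proof -
  have p: "has_bochner_integral M (\<lambda>\<omega>. (w \<bullet> u \<omega>) ^ 4) (3 * (w \<bullet> (S *v w)) ^ 2)" for w
    using centred_gaussian_power[OF G, of w 4] by (simp add: fact_numeral power2_eq_square)
  have sym: "b \<bullet> (S *v a) = a \<bullet> (S *v b)" "c \<bullet> (S *v a) = a \<bullet> (S *v c)"
    "d \<bullet> (S *v a) = a \<bullet> (S *v d)" "c \<bullet> (S *v b) = b \<bullet> (S *v c)"
    "d \<bullet> (S *v b) = b \<bullet> (S *v d)" "d \<bullet> (S *v c) = c \<bullet> (S *v d)"
    using G by (simp_all add: centred_gaussian_def inner_symmetric_matrix)
  have polarize: "((x + y + z + v) ^ 4 + (x + y - z - v) ^ 4 + ((x - y + z - v) ^ 4 + (x - y - z + v) ^ 4)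
      - ((x + y + z - v) ^ 4 + (x + y - z + v) ^ 4 + ((x - y + z + v) ^ 4 + (x - y - z - v) ^ 4))) / 192
      = x * y * z * v" for x y z v :: real
    by algebra
  show ?thesis
    apply (rule has_bochner_integral_eq[OF has_bochner_integral_divide_zero
        [OF has_bochner_integral_diff[OF
          has_bochner_integral_add[OF
            has_bochner_integral_add[OF p[of "a + b + c + d"] p[of "a + b - c - d"]]
            has_bochner_integral_add[OF p[of "a - b + c - d"] p[of "a - b - c + d"]]]
          has_bochner_integral_add[OF
            has_bochner_integral_add[OF p[of "a + b + c - d"] p[of "a + b - c + d"]]
            has_bochner_integral_add[OF p[of "a - b + c + d"] p[of "a - b - c - d"]]]], of 192]])
    subgoal by (simp only: inner_add_left inner_diff_left polarize)
    subgoal unfolding matrix_vector_right_distrib matrix_vector_mult_diff_distrib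
        inner_add_left inner_diff_left inner_add_right inner_diff_right sym
      by algebra
    done
qed

end

section \<open>Moments of polynomials of degree two in a Gaussian vector\<close>

text \<open>With the factor -1/2 split off, the quadratic coefficient of the log-likelihood is the
  inverse covariance itself, and those of its derivatives are the derivatives of that
  inverse.\<close>

definition lin_quad :: "real \<Rightarrow> real^'m \<Rightarrow> real^'m^'m \<Rightarrow> real^'m::finite \<Rightarrow> real"
  where "lin_quad c b A u = c + b \<bullet> u - (1/2) * (u \<bullet> (A *v u))"

context
  fixes M :: "'w measure" and u :: "'w \<Rightarrow> real^'m::finite" and S :: "real^'m^'m"
  assumes G: "centred_gaussian M u S"
begin

lemma centred_gaussian_symmetric: "transpose S = S"
  using G by (simp add: centred_gaussian_def)

lemma centred_gaussian_const: "has_bochner_integral M (\<lambda>\<omega>. c :: real) c"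
proof -
  interpret prob_space M using G by (simp add: centred_gaussian_def)
  show ?thesis by (simp add: has_bochner_integral_iff prob_space)
qed

lemma centred_gaussian_quadratic:
  "has_bochner_integral M (\<lambda>\<omega>. u \<omega> \<bullet> (A *v u \<omega>)) (trace (A ** S))"
proof -
  have sym: "S $ i $ j = S $ j $ i" for i j
    by (rule symmetric_matrix_entry[OF centred_gaussian_symmetric])
  show ?thesis unfolding quadratic_form_axis
    by (rule has_bochner_integral_eq[OF has_bochner_integral_sum[OF has_bochner_integral_sum
        [OF has_bochner_integral_mult_right[OF centred_gaussian_moment2[OF G]]]]])
      (auto simp: axis_inner_matrix_axis trace_def matrix_matrix_mult_def sym intro!: sum.cong)
qed

lemma centred_gaussian_linear_quadratic:
  "has_bochner_integral M (\<lambda>\<omega>. (b \<bullet> u \<omega>) * (u \<omega> \<bullet> (A *v u \<omega>))) 0"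
proof -
  have e: "(b \<bullet> v) * (v \<bullet> (A *v v)) = (\<Sum>i\<in>UNIV. \<Sum>j\<in>UNIV.
      A $ i $ j * ((b \<bullet> v) * (axis i 1 \<bullet> v) * (axis j 1 \<bullet> v)))" for v
    unfolding quadratic_form_axis by (simp add: sum_distrib_left mult_ac)
  show ?thesis unfolding e
    by (rule has_bochner_integral_eq[OF has_bochner_integral_sum[OF has_bochner_integral_sum
        [OF has_bochner_integral_mult_right[OF centred_gaussian_moment3[OF G]]]]])
      auto
qed

text \<open>Of the three pairings, the one inside each form yields the product of traces. The two
  crossing ones yield the same trace, since \<open>B\<close> is symmetric, hence the factor
  2.\<close>

lemma centred_gaussian_quadratic_quadratic:
  assumes "transpose B = B"
  shows "has_bochner_integral M (\<lambda>\<omega>. (u \<omega> \<bullet> (A *v u \<omega>)) * (u \<omega> \<bullet> (B *v u \<omega>)))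
    (trace (A ** S) * trace (B ** S) + 2 * trace (A ** S ** B ** S))"
proof -
  have sym: "S $ i $ j = S $ j $ i" for i j
    by (rule symmetric_matrix_entry[OF centred_gaussian_symmetric])
  have symB: "B $ i $ j = B $ j $ i" for i j
    by (rule symmetric_matrix_entry[OF assms])
  have e: "(v \<bullet> (A *v v)) * (v \<bullet> (B *v v))
    = (\<Sum>i\<in>UNIV. \<Sum>j\<in>UNIV. \<Sum>k\<in>UNIV. \<Sum>l\<in>UNIV. A $ i $ j * B $ k $ l *
        ((axis i 1 \<bullet> v) * (axis j 1 \<bullet> v) * (axis k 1 \<bullet> v) * (axis l 1 \<bullet> v)))" for v
    unfolding quadratic_form_axis
    by (simp only: sum_distrib_right) (simp only: sum_distrib_left mult_ac)
  have trace_S: "trace (Q ** S) = (\<Sum>i\<in>UNIV. \<Sum>j\<in>UNIV. Q $ i $ j * S $ i $ j)" for Q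
    unfolding trace_def matrix_matrix_mult_def vec_lambda_beta
    by (intro sum.cong refl arg_cong[where f = "(*) _"] sym)
  have t1: "(\<Sum>i\<in>UNIV. \<Sum>j\<in>UNIV. \<Sum>k\<in>UNIV. \<Sum>l\<in>UNIV. A $ i $ j * B $ k $ l * (S $ i $ j * S $ k $ l))
      = trace (A ** S) * trace (B ** S)"
    unfolding trace_S
    by (simp only: sum_distrib_right) (simp only: sum_distrib_left mult_ac)
  have t2: "(\<Sum>i\<in>UNIV. \<Sum>j\<in>UNIV. \<Sum>k\<in>UNIV. \<Sum>l\<in>UNIV. A $ i $ j * B $ k $ l * (S $ i $ l * S $ j $ k))
      = trace (A ** S ** B ** S)"
    unfolding trace_four_products by (intro sum.cong refl) (simp add: sym mult_ac)
  have t3: "(\<Sum>i\<in>UNIV. \<Sum>j\<in>UNIV. \<Sum>k\<in>UNIV. \<Sum>l\<in>UNIV. A $ i $ j * B $ k $ l * (S $ i $ k * S $ j $ l))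
      = trace (A ** S ** B ** S)"
    unfolding t2[symmetric]
    by (rule sum.cong[OF refl], rule sum.cong[OF refl], subst sum.swap, intro sum.cong refl)
      (simp add: symB mult_ac)
  show ?thesis unfolding e
    apply (rule has_bochner_integral_eq[OF has_bochner_integral_sum[OF has_bochner_integral_sum
        [OF has_bochner_integral_sum[OF has_bochner_integral_sum
        [OF has_bochner_integral_mult_right[OF centred_gaussian_moment4[OF G]]]]]]])
     apply (rule refl)
    unfolding axis_inner_matrix_axis distrib_left sum.distrib t1 t2 t3
    by simp
qed

lemma lin_quad_mean:
  "has_bochner_integral M (\<lambda>\<omega>. lin_quad c b A (u \<omega>)) (c - (1/2) * trace (A ** S))"
  unfolding lin_quad_def
  by (rule has_bochner_integral_eq[OF has_bochner_integral_diff[OF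
        has_bochner_integral_add[OF centred_gaussian_const centred_gaussian_moment1[OF G]]
        has_bochner_integral_mult_right[OF centred_gaussian_quadratic, of "1/2"]]]) auto

text \<open>Product of the means plus the covariance; linear and quadratic parts do not interact
  because third moments vanish.\<close>

lemma lin_quad_product:
  assumes "transpose A' = A'"
  shows "has_bochner_integral M (\<lambda>\<omega>. lin_quad c b A (u \<omega>) * lin_quad c' b' A' (u \<omega>))
    ((c - (1/2) * trace (A ** S)) * (c' - (1/2) * trace (A' ** S))
      + b \<bullet> (S *v b') + (1/2) * trace (A ** S ** A' ** S))"
proof -
  \<comment> \<open>The product is expanded only partly: the summand with factor \<open>c\<close>
    keeps the second polynomial whole, so that \<open>lin_quad_mean\<close> covers it.\<close>
  have "has_bochner_integral M (\<lambda>\<omega>. c * lin_quad c' b' A' (u \<omega>) + c' * (b \<bullet> u \<omega>)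
      + (b \<bullet> u \<omega>) * (b' \<bullet> u \<omega>) + (-1/2) * ((b \<bullet> u \<omega>) * (u \<omega> \<bullet> (A' *v u \<omega>)))
      + (-1/2) * c' * (u \<omega> \<bullet> (A *v u \<omega>)) + (-1/2) * ((b' \<bullet> u \<omega>) * (u \<omega> \<bullet> (A *v u \<omega>)))
      + (1/4) * ((u \<omega> \<bullet> (A *v u \<omega>)) * (u \<omega> \<bullet> (A' *v u \<omega>))))
    (c * (c' - (1/2) * trace (A' ** S)) + c' * 0 + b \<bullet> (S *v b') + (-1/2) * 0
      + (-1/2) * c' * trace (A ** S) + (-1/2) * 0
      + (1/4) * (trace (A ** S) * trace (A' ** S) + 2 * trace (A ** S ** A' ** S)))"
    by (intro has_bochner_integral_add has_bochner_integral_mult_right lin_quad_mean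
        centred_gaussian_moment1[OF G] centred_gaussian_moment2[OF G]
        centred_gaussian_linear_quadratic centred_gaussian_quadratic
        centred_gaussian_quadratic_quadratic assms)
  then show ?thesis
    by (rule has_bochner_integral_eq) (simp_all add: lin_quad_def field_simps)
qed

end

text \<open>Completing the square turns the exponential tilt of the density into a translate of it,
  and Lebesgue measure is translation invariant.\<close>

lemma mvn_density_exp_moment:
  fixes A :: "real^'q::finite^'q"
  assumes Y: "distributed M lborel Y (mvn_density m A)" and M: "prob_space M"
    and A: "transpose A = A" "invertible A"
  shows "(\<integral>\<^sup>+\<omega>. ennreal (exp (w \<bullet> (Y \<omega> - m))) \<partial>M) = ennreal (exp (w \<bullet> (A *v w) / 2))"
proof -
  interpret prob_space M by (rule M)
  let ?f = "mvn_density m A" and ?c = "A *v w"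
  have f [measurable]: "(\<lambda>x. ennreal (?f x)) \<in> borel_measurable borel"
    using distributed_borel_measurable[OF Y] by simp
  have sym: "transpose (matrix_inv A) = matrix_inv A"
    using A transpose_matrix_inv by metis
  have cancel: "matrix_inv A *v ?c = w"
    using matrix_inv_inverse(2)[OF A(2)] by (simp add: matrix_vector_mul_assoc)
  have tilt: "exp (w \<bullet> (x - m)) * ?f x = exp (w \<bullet> ?c / 2) * ?f (- ?c + x)" for x
  proof -
    let ?z = "x - m"
    have "?c \<bullet> (matrix_inv A *v ?z) = w \<bullet> ?z"
      using inner_symmetric_matrix[OF sym, of ?c ?z] cancel by (simp add: inner_commute)
    then have "(?z - ?c) \<bullet> (matrix_inv A *v (?z - ?c))
        = ?z \<bullet> (matrix_inv A *v ?z) - 2 * (w \<bullet> ?z) + w \<bullet> ?c"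
      by (simp add: matrix_vector_mult_diff_distrib cancel inner_simps inner_commute)
    then have "w \<bullet> ?z - ?z \<bullet> (matrix_inv A *v ?z) / 2
        = w \<bullet> ?c / 2 - (?z - ?c) \<bullet> (matrix_inv A *v (?z - ?c)) / 2"
      by (simp add: field_simps)
    moreover have shift: "- ?c + x - m = ?z - ?c" by simp
    ultimately show ?thesis
      unfolding mvn_density_def shift by (simp add: exp_add[symmetric])
  qed
  have "(\<integral>\<^sup>+\<omega>. ennreal (exp (w \<bullet> (Y \<omega> - m))) \<partial>M)
      = (\<integral>\<^sup>+x. ennreal (?f x) * ennreal (exp (w \<bullet> (x - m))) \<partial>lborel)"
    by (rule distributed_nn_integral[OF Y, symmetric]) measurable
  also have "\<dots> = (\<integral>\<^sup>+x. ennreal (exp (w \<bullet> ?c / 2)) * ennreal (?f (- ?c + x)) \<partial>lborel)"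
    by (rule nn_integral_cong) (metis tilt ennreal_mult' exp_ge_zero mult.commute)
  also have "\<dots> = ennreal (exp (w \<bullet> ?c / 2)) * (\<integral>\<^sup>+x. ennreal (?f (- ?c + x)) \<partial>lborel)"
    by (rule nn_integral_cmult) measurable
  also have "(\<integral>\<^sup>+x. ennreal (?f (- ?c + x)) \<partial>lborel) = (\<integral>\<^sup>+x. ennreal (?f x) \<partial>distr lborel borel ((+) (- ?c)))"
    by (rule nn_integral_distr[symmetric]) measurable
  also have "\<dots> = (\<integral>\<^sup>+x. ennreal (?f x) * 1 \<partial>lborel)"
    by (simp only: lborel_distr_plus mult_1_right)
  \<comment> \<open>The density has total mass 1 because it is the density of \<open>Y\<close> under
    a probability measure, so no Gaussian integral has to be evaluated.\<close>
  also have "\<dots> = (\<integral>\<^sup>+\<omega>. 1 \<partial>M)"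
    by (rule distributed_nn_integral[OF Y]) measurable
  finally show ?thesis by (simp add: emeasure_space_1)
qed

text \<open>The exponent is a sum over blocks, so by independence the generating function is the
  product of the block generating functions.\<close>

lemma stacked_gaussian:
  fixes Y :: "'n::finite \<Rightarrow> 'w \<Rightarrow> real^'q::finite"
  assumes M: "prob_space M"
    and indep: "prob_space.indep_vars M (\<lambda>_. borel) Y UNIV"
    and Y: "\<And>i. distributed M lborel (Y i) (mvn_density (m i) (A i))"
    and A: "\<And>i. transpose (A i) = A i" "\<And>i. invertible (A i)"
  shows "centred_gaussian M (\<lambda>\<omega>. stack_vec (\<lambda>i. Y i \<omega>) - stack_vec m) (block_diag A)"
proof -
  interpret prob_space M by (rule M)
  have meas [measurable]: "Y i \<in> borel_measurable M" for i
    using distributed_measurable[OF Y] by simp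
  have [measurable]: "(\<lambda>\<omega>. Y i \<omega> $ j) \<in> borel_measurable M" for i j
    using borel_measurable_inner[OF meas[of i] borel_measurable_const, of "axis j 1"]
    by (simp add: inner_axis)
  let ?u = "\<lambda>\<omega>. stack_vec (\<lambda>i. Y i \<omega>) - stack_vec m"
  have "?u \<in> borel_measurable M"
    unfolding borel_measurable_euclidean_space[of ?u] by (simp add: inner_vec_def stack_vec_def)
  moreover have "transpose (block_diag A) = block_diag A"
    by (rule transpose_block_diag) (rule A(1))
  moreover have "(\<integral>\<^sup>+\<omega>. ennreal (exp (w \<bullet> ?u \<omega>)) \<partial>M) = ennreal (exp (w \<bullet> (block_diag A *v w) / 2))" for w
  proof -
    let ?w = "\<lambda>i. \<chi> j. w $ (i, j)"
    have "indep_vars (\<lambda>_. borel) (\<lambda>i \<omega>. ennreal (exp (?w i \<bullet> (Y i \<omega> - m i)))) UNIV"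
      by (rule indep_vars_compose2[OF indep, where Y = "\<lambda>i y. ennreal (exp (?w i \<bullet> (y - m i)))"]) measurable
    then have "(\<integral>\<^sup>+\<omega>. (\<Prod>i\<in>UNIV. ennreal (exp (?w i \<bullet> (Y i \<omega> - m i)))) \<partial>M)
        = (\<Prod>i\<in>UNIV. \<integral>\<^sup>+\<omega>. ennreal (exp (?w i \<bullet> (Y i \<omega> - m i))) \<partial>M)"
      by (intro indep_vars_nn_integral) auto
    moreover have "w \<bullet> ?u \<omega> = (\<Sum>i\<in>UNIV. ?w i \<bullet> (Y i \<omega> - m i))" for \<omega>
      unfolding inner_stack[of w] by (simp add: inner_vec_def stack_vec_def)
    moreover have "w \<bullet> (block_diag A *v w) / 2 = (\<Sum>i\<in>UNIV. ?w i \<bullet> (A i *v ?w i) / 2)"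
      unfolding inner_stack[of w] block_diag_mult_vec
      by (simp add: stack_vec_def sum_divide_distrib inner_vec_def)
    ultimately show ?thesis
      by (simp add: exp_sum prod_ennreal[symmetric] mvn_density_exp_moment[OF Y M A])
  qed
  ultimately show ?thesis using M unfolding centred_gaussian_def by blast
qed

section \<open>Partial derivatives\<close>

text \<open>Relational form of \<open>partial_deriv\<close>, which also denotes a value where no
  derivative exists.\<close>

definition has_partial ::
  "'p::finite \<Rightarrow> (real^'p \<Rightarrow> 'b::real_normed_vector) \<Rightarrow> real^'p \<Rightarrow> 'b \<Rightarrow> bool"
  where "has_partial r f x D \<longleftrightarrow>
    ((\<lambda>t. f (x + t *\<^sub>R axis r 1)) has_vector_derivative D) (at 0)"

lemma has_partial_imp_partial_deriv: "has_partial r f x D \<Longrightarrow> partial_deriv r f x = D"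
  unfolding has_partial_def partial_deriv_def by (rule vector_derivative_at)

lemma has_partial_unique: "has_partial r f x D \<Longrightarrow> has_partial r f x E \<Longrightarrow> D = E"
  unfolding has_partial_def by (rule vector_derivative_unique_at)

text \<open>Agreement on \<open>T\<close> is enough because the coordinate line through
  \<open>x\<close> meets \<open>T\<close> in an open neighbourhood of \<open>x\<close>.\<close>

lemma has_partial_cong:
  assumes "open T" "x \<in> T" "\<And>y. y \<in> T \<Longrightarrow> f y = g y" "has_partial r f x D"
  shows "has_partial r g x D"
proof -
  let ?S = "(\<lambda>t. x + t *\<^sub>R axis r (1::real)) -` T"
  have "open ?S"
    by (rule open_vimage[OF assms(1)]) (intro continuous_intros)
  then show ?thesis
    using assms(2,3) unfolding has_partial_def
    by (intro has_vector_derivative_transform_within_open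
        [OF assms(4)[unfolded has_partial_def] \<open>open ?S\<close>]) auto
qed

lemma has_partial_exists_cong:
  assumes "open T" "x \<in> T" "\<exists>D. has_partial r f x D" "\<And>y. y \<in> T \<Longrightarrow> f y = g y"
  shows "\<exists>D. has_partial r g x D"
  using assms has_partial_cong by metis

lemma partial_deriv_cong:
  assumes "open T" "x \<in> T" "\<And>y. y \<in> T \<Longrightarrow> f y = g y" "has_partial r g x D"
  shows "partial_deriv r f x = D"
  using assms by (intro has_partial_imp_partial_deriv has_partial_cong[of T x g f]) auto

lemma has_partial_const: "has_partial r (\<lambda>_. c) x 0"
  by (simp add: has_partial_def)

lemma has_partial_add:
  "has_partial r f x D \<Longrightarrow> has_partial r g x E \<Longrightarrow> has_partial r (\<lambda>x. f x + g x) x (D + E)"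
  unfolding has_partial_def by (rule has_vector_derivative_add)

lemma has_partial_diff:
  "has_partial r f x D \<Longrightarrow> has_partial r g x E \<Longrightarrow> has_partial r (\<lambda>x. f x - g x) x (D - E)"
  unfolding has_partial_def by (rule has_vector_derivative_diff)

lemma has_partial_minus:
  "has_partial r f x D \<Longrightarrow> has_partial r (\<lambda>x. - f x) x (- D)"
  unfolding has_partial_def by (rule has_vector_derivative_minus)

lemma (in bounded_linear) has_partial:
  "has_partial r g x D \<Longrightarrow> has_partial r (\<lambda>x. f (g x)) x (f D)"
  unfolding has_partial_def by (rule has_vector_derivative)

lemma (in bounded_bilinear) has_partial:
  assumes "has_partial r f x D" "has_partial r g x E"
  shows "has_partial r (\<lambda>x. prod (f x) (g x)) x (prod (f x) E + prod D (g x))"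
  using has_vector_derivative[OF assms[unfolded has_partial_def]]
  by (simp add: has_partial_def)

lemmas has_partial_matrix_mult = bounded_bilinear.has_partial[OF bounded_bilinear_matrix_mult]
lemmas has_partial_matrix_vector_mult =
  bounded_bilinear.has_partial[OF bounded_bilinear_matrix_vector_mult]
lemmas has_partial_trace = bounded_linear.has_partial[OF bounded_linear_trace]
lemmas has_partial_inner = bounded_bilinear.has_partial[OF bounded_bilinear_inner]

lemma has_partial_cmult:
  "has_partial r f x D \<Longrightarrow> has_partial r (\<lambda>x. c * f x) x (c * D)" for c :: real
  by (rule bounded_linear.has_partial[OF bounded_linear_mult_right])

lemma has_vector_derivative_vec:
  fixes f :: "real \<Rightarrow> 'b::real_normed_vector^'a::finite"
  assumes "\<And>i. ((\<lambda>t. f t $ i) has_vector_derivative D $ i) (at x)"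
  shows "(f has_vector_derivative D) (at x)"
proof -
  have "((\<lambda>y. ((f y - f x) - (y - x) *\<^sub>R D) /\<^sub>R norm (y - x)) \<longlongrightarrow> 0) (at x)"
  proof (rule vec_tendstoI)
    show "((\<lambda>y. (((f y - f x) - (y - x) *\<^sub>R D) /\<^sub>R norm (y - x)) $ i) \<longlongrightarrow> 0 $ i) (at x)" for i
      using assms[of i] by (simp add: has_vector_derivative_def has_derivative_at_within)
  qed
  then show ?thesis
    by (simp add: has_vector_derivative_def has_derivative_at_within bounded_linear_scaleR_left)
qed

lemma has_partial_vec:
  assumes "\<And>i. has_partial r (\<lambda>x. f x $ i) x (D $ i)"
  shows "has_partial r f x D"
  using assms unfolding has_partial_def by (intro has_vector_derivative_vec) auto

lemma has_partial_vec_exists: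
  assumes "\<And>i. \<exists>D. has_partial r (\<lambda>x. f x $ i) x D"
  shows "\<exists>D. has_partial r f x D"
proof -
  from assms obtain D where "\<And>i. has_partial r (\<lambda>x. f x $ i) x (D i)" by metis
  then have "has_partial r f x (\<chi> i. D i)" by (intro has_partial_vec) simp
  then show ?thesis ..
qed

section \<open>Derivatives of determinants and inverse matrices\<close>

text \<open>In the differentiated Leibniz formula only the identity permutation survives: any other
  moves at least two points, so besides the differentiated factor an off-diagonal zero
  remains.\<close>

lemma has_vector_derivative_det_at_identity:
  fixes A :: "real \<Rightarrow> real^'n::finite^'n"
  assumes A: "(A has_vector_derivative A') (at x)" and "A x = mat 1"
  shows "((\<lambda>t. det (A t)) has_real_derivative trace A') (at x)"
proof -
  have entry: "((\<lambda>t. A t $ i $ j) has_real_derivative A' $ i $ j) (at x)" for i j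
    using bounded_linear.has_vector_derivative[OF bounded_linear_vec_nth
        bounded_linear.has_vector_derivative[OF bounded_linear_vec_nth A]]
    by (simp add: has_real_derivative_iff_has_vector_derivative)
  let ?D = "\<lambda>p. \<Sum>i\<in>UNIV. A' $ i $ p i * (\<Prod>j\<in>UNIV - {i}. A x $ j $ p j)"
  have "((\<lambda>t. det (A t)) has_real_derivative
      (\<Sum>p | p permutes UNIV. of_int (sign p) * ?D p)) (at x)"
    unfolding det_def
    by (intro DERIV_sum DERIV_cmult) (rule has_field_derivative_prod[OF entry])
  moreover have D: "?D p = (if p = id then trace A' else 0)" if "p permutes UNIV" for p
  proof (cases "p = id")
    case True
    then show ?thesis using \<open>A x = mat 1\<close> by (simp add: trace_def mat_def)
  next
    case False
    have "(\<Prod>j\<in>UNIV - {i}. A x $ j $ p j) = 0" for i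
    proof -
      obtain k where k: "p k \<noteq> k" using False by (auto simp: fun_eq_iff)
      have "p (p k) \<noteq> p k" using k permutes_inj[OF that] by (simp add: inj_eq)
      then have "\<exists>j. j \<noteq> i \<and> p j \<noteq> j" using k by metis
      then obtain j where "j \<noteq> i" "p j \<noteq> j" by blast
      then show ?thesis
        using \<open>A x = mat 1\<close> by (intro prod_zero bexI[of _ j]) (auto simp: mat_def)
    qed
    then show ?thesis using False by (simp del: prod_zero_iff)
  qed
  have "(\<Sum>p | p permutes UNIV. of_int (sign p) * ?D p)
      = (\<Sum>p :: 'n \<Rightarrow> 'n | p permutes UNIV. if p = id then trace A' else 0)"
    by (rule sum.cong[OF refl]) (simp add: D)
  then have "(\<Sum>p | p permutes UNIV. of_int (sign p) * ?D p) = trace A'"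
    using permutes_id by (simp add: sum.delta' finite_permutations)
  ultimately show ?thesis by simp
qed

lemma has_partial_vec_nth:
  "has_partial r f x D \<Longrightarrow> has_partial r (\<lambda>x. f x $ i) x (D $ i)"
  by (rule bounded_linear.has_partial[OF bounded_linear_vec_nth])

text \<open>The real \<open>ln\<close> is an even function here, which carries the formula over to
  negative arguments and lets \<open>ln (det (A x))\<close> be differentiated from invertibility
  alone.\<close>

lemma DERIV_ln_nonzero:
  fixes x :: real
  assumes "x \<noteq> 0"
  shows "(ln has_real_derivative 1 / x) (at x)"
proof (cases "x > 0")
  case False
  then have "((\<lambda>y. ln (- y)) has_real_derivative 1 / x) (at x)"
    using assms by (auto intro!: derivative_eq_intros)
  then show ?thesis by (simp add: ln_minus)
qed (rule DERIV_ln_divide)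

text \<open>Jacobi's formula. Factoring out \<open>det (A x)\<close> leaves the determinant of
  \<open>matrix_inv (A x) ** A y\<close>, which is the identity at \<open>y = x\<close>.\<close>

lemma has_partial_det:
  fixes A :: "real^'p::finite \<Rightarrow> real^'n::finite^'n"
  assumes A: "has_partial r A x A'" and inv: "invertible (A x)"
  shows "has_partial r (\<lambda>x. det (A x)) x (det (A x) * trace (matrix_inv (A x) ** A'))"
proof -
  have "((\<lambda>t. matrix_inv (A x) ** A (x + t *\<^sub>R axis r 1)) has_vector_derivative
      matrix_inv (A x) ** A') (at 0)"
    using has_partial_matrix_mult[OF has_partial_const A, of "matrix_inv (A x)"]
    by (simp add: has_partial_def)
  then have "((\<lambda>t. det (matrix_inv (A x) ** A (x + t *\<^sub>R axis r 1))) has_real_derivative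
      trace (matrix_inv (A x) ** A')) (at 0)"
    by (rule has_vector_derivative_det_at_identity) (simp add: matrix_inv_inverse inv)
  then have "((\<lambda>t. det (A x) * det (matrix_inv (A x) ** A (x + t *\<^sub>R axis r 1))) has_real_derivative
      det (A x) * trace (matrix_inv (A x) ** A')) (at 0)"
    by (rule DERIV_cmult)
  moreover have "det (A x) * det (matrix_inv (A x) ** B) = det B" for B
    by (metis det_mul inv matrix_inv_inverse(1) matrix_mul_assoc matrix_mul_lid)
  ultimately show ?thesis
    by (simp add: has_partial_def has_real_derivative_iff_has_vector_derivative)
qed

lemma has_partial_ln_det:
  fixes A :: "real^'p::finite \<Rightarrow> real^'n::finite^'n"
  assumes A: "has_partial r A x A'" and inv: "invertible (A x)"
  shows "has_partial r (\<lambda>x. ln (det (A x))) x (trace (matrix_inv (A x) ** A'))"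
proof -
  have nz: "det (A x) \<noteq> 0" using inv by (simp add: invertible_det_nz)
  have "((\<lambda>t. ln (det (A (x + t *\<^sub>R axis r 1)))) has_real_derivative
      1 / det (A x) * (det (A x) * trace (matrix_inv (A x) ** A'))) (at 0)"
    using has_partial_det[OF assms] DERIV_ln_nonzero[OF nz]
    by (intro DERIV_chain2[where f = ln])
      (simp_all add: has_partial_def has_real_derivative_iff_has_vector_derivative)
  then show ?thesis
    using nz by (simp add: has_partial_def has_real_derivative_iff_has_vector_derivative)
qed

lemma has_partial_divide:
  fixes f g :: "real^'p::finite \<Rightarrow> real"
  assumes "has_partial r f x D" "has_partial r g x E" "g x \<noteq> 0"
  shows "has_partial r (\<lambda>x. f x / g x) x ((D * g x - f x * E) / (g x * g x))"
  using DERIV_divide[of "\<lambda>t. f (x + t *\<^sub>R axis r 1)" D 0 UNIV "\<lambda>t. g (x + t *\<^sub>R axis r 1)" E] assms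
  by (simp add: has_partial_def has_real_derivative_iff_has_vector_derivative)

text \<open>Meant for the numerators in Cramer's rule, which may be singular at \<open>x\<close>,
  where Jacobi's formula in the form above does not apply.\<close>

lemma has_partial_det_exists:
  fixes A :: "real^'p::finite \<Rightarrow> real^'n::finite^'n"
  assumes "\<And>i j. \<exists>D. has_partial r (\<lambda>x. A x $ i $ j) x D"
  shows "\<exists>D. has_partial r (\<lambda>x. det (A x)) x D"
proof -
  from assms obtain D where D: "\<And>i j. has_partial r (\<lambda>x. A x $ i $ j) x (D i j)"
    by metis
  have "((\<lambda>t. det (A (x + t *\<^sub>R axis r 1))) has_real_derivative
      (\<Sum>p | p permutes UNIV. of_int (sign p) *
        (\<Sum>i\<in>UNIV. D i (p i) * (\<Prod>j\<in>UNIV - {i}. A (x + 0 *\<^sub>R axis r 1) $ j $ p j)))) (at 0)"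
    unfolding det_def
    by (intro DERIV_sum DERIV_cmult) 
      (rule has_field_derivative_prod, use D in \<open>simp add: has_partial_def has_real_derivative_iff_has_vector_derivative\<close>)
  then show ?thesis
    by (auto simp: has_partial_def has_real_derivative_iff_has_vector_derivative)
qed

text \<open>Cramer's rule gives existence of the derivative; differentiating the product of the
  inverse with \<open>A\<close>, constant on \<open>T\<close>, then determines its value.\<close>

lemma has_partial_matrix_inv:
  fixes A :: "real^'p::finite \<Rightarrow> real^'n::finite^'n"
  assumes T: "open T" "x \<in> T" and inv: "\<And>y. y \<in> T \<Longrightarrow> invertible (A y)"
    and A: "has_partial r A x A'"
  shows "has_partial r (\<lambda>x. matrix_inv (A x)) x (- (matrix_inv (A x) ** A' ** matrix_inv (A x)))"
proof -
  let ?P = "\<lambda>x. matrix_inv (A x)"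
  have "\<exists>D. has_partial r (\<lambda>x. det (\<chi> i j. if j = k then axis l 1 $ i else A x $ i $ j) / det (A x)) x D"
    for k l
  proof -
    have "\<exists>D. has_partial r (\<lambda>x. det (\<chi> i j. if j = k then axis l 1 $ i else A x $ i $ j)) x D"
    proof (rule has_partial_det_exists)
      show "\<exists>D. has_partial r (\<lambda>x. (\<chi> i j. if j = k then axis l 1 $ i else A x $ i $ j) $ i $ j) x D"
        for i j
        using has_partial_const has_partial_vec_nth[OF has_partial_vec_nth[OF A]]
        by (cases "j = k") (simp_all, blast+)
    qed
    then obtain E where
      "has_partial r (\<lambda>x. det (\<chi> i j. if j = k then axis l 1 $ i else A x $ i $ j)) x E" ..
    from has_partial_divide[OF this has_partial_det[OF A inv[OF T(2)]]] inv[OF T(2)]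
    show ?thesis by (auto simp: invertible_det_nz)
  qed
  then have "\<exists>D. has_partial r (\<lambda>x. ?P x $ k $ l) x D" for k l
    by (rule has_partial_exists_cong[OF T]) (rule matrix_inv_cramer[OF inv, symmetric])
  then have "\<exists>D. has_partial r ?P x D"
    by (intro has_partial_vec_exists)
  then obtain D where P: "has_partial r ?P x D" ..
  have "has_partial r (\<lambda>x. ?P x ** A x) x (?P x ** A' + D ** A x)"
    by (rule has_partial_matrix_mult[OF P A])
  moreover have "has_partial r (\<lambda>x. ?P x ** A x) x 0"
    by (rule has_partial_cong[OF T _ has_partial_const[of _ "mat 1"]])
      (simp add: matrix_inv_inverse inv)
  ultimately have "?P x ** A' + D ** A x = 0"
    by (rule has_partial_unique)
  then have "(?P x ** A' + D ** A x) ** ?P x = 0"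
    by (simp add: matrix_matrix_mult_def vec_eq_iff)
  then have "?P x ** A' ** ?P x + D = 0"
    using matrix_inv_inverse[OF inv[OF T(2)]]
    by (simp add: matrix_mult_add_left flip: matrix_mul_assoc)
  then have "D = - (?P x ** A' ** ?P x)"
    by (simp add: eq_neg_iff_add_eq_0 add.commute)
  with P show ?thesis by simp
qed

text \<open>The residual \<open>y - m x\<close> has derivative \<open>- a\<close>. By symmetry of
  \<open>A x\<close> the two terms this produces in the quadratic form merge into
  \<open>(A x *v a) \<bullet> (y - m x)\<close>, so the result has the same shape again.\<close>

lemma has_partial_lin_quad:
  fixes y :: "real^'m::finite"
  assumes c: "has_partial r c x c'" and b: "has_partial r b x b'"
    and A: "has_partial r A x A'" and m: "has_partial r m x a"
    and sym: "transpose (A x) = A x"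
  shows "has_partial r (\<lambda>x. lin_quad (c x) (b x) (A x) (y - m x)) x
    (lin_quad (c' - b x \<bullet> a) (b' + A x *v a) A' (y - m x))"
proof -
  have u: "has_partial r (\<lambda>x. y - m x) x (- a)"
    using has_partial_diff[OF has_partial_const m] by simp
  define v where "v = y - m x"
  have "v \<bullet> (A x *v a) = a \<bullet> (A x *v v)"
    by (rule inner_symmetric_matrix[OF sym])
  moreover have "A x *v (- a) = - (A x *v a)"
    by (simp add: vec_eq_iff matrix_vector_mult_def sum_negf)
  ultimately have "c' + (b x \<bullet> (- a) + b' \<bullet> v)
      - (1/2) * (v \<bullet> (A x *v (- a) + A' *v v) + (- a) \<bullet> (A x *v v))
      = lin_quad (c' - b x \<bullet> a) (b' + A x *v a) A' v"
    by (simp add: lin_quad_def inner_add_left inner_add_right inner_commute[of "A x *v a"]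
        algebra_simps)
  moreover have "has_partial r (\<lambda>x. lin_quad (c x) (b x) (A x) (y - m x)) x
    (c' + (b x \<bullet> (- a) + b' \<bullet> v)
      - (1/2) * (v \<bullet> (A x *v (- a) + A' *v v) + (- a) \<bullet> (A x *v v)))"
    unfolding lin_quad_def v_def
    by (intro has_partial_diff has_partial_add has_partial_cmult has_partial_inner
        has_partial_matrix_vector_mult c b A u)
  ultimately show ?thesis by (simp add: v_def)
qed

section \<open>Derivatives of the log-likelihood\<close>

locale gaussian_family =
  fixes T :: "(real^'p::finite) set"
    and m :: "real^'p \<Rightarrow> real^'m::finite"
    and S :: "real^'p \<Rightarrow> real^'m^'m"
  assumes T: "open T"
    and inv: "x \<in> T \<Longrightarrow> invertible (S x)"
    and sym: "x \<in> T \<Longrightarrow> transpose (S x) = S x"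
    and m1: "x \<in> T \<Longrightarrow> has_partial r m x (partial_deriv r m x)"
    and m2: "x \<in> T \<Longrightarrow> has_partial s (partial_deriv r m) x (partial_deriv s (partial_deriv r m) x)"
    and m3: "x \<in> T \<Longrightarrow> has_partial t (partial_deriv s (partial_deriv r m)) x
      (partial_deriv t (partial_deriv s (partial_deriv r m)) x)"
    and S1: "x \<in> T \<Longrightarrow> has_partial r S x (partial_deriv r S x)"
    and S2: "x \<in> T \<Longrightarrow> has_partial s (partial_deriv r S) x (partial_deriv s (partial_deriv r S) x)"
    and S3: "x \<in> T \<Longrightarrow> has_partial t (partial_deriv s (partial_deriv r S)) x
      (partial_deriv t (partial_deriv s (partial_deriv r S)) x)"
begin

section \<open>The inverse covariance and its derivatives\<close>

abbreviation "a r \<equiv> partial_deriv r m"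
abbreviation "a2 s r \<equiv> partial_deriv s (partial_deriv r m)"
abbreviation "C r \<equiv> partial_deriv r S"
abbreviation "C2 s r \<equiv> partial_deriv s (partial_deriv r S)"

text \<open>\<open>W1\<close> and \<open>W2\<close> are the first and second derivatives of
  \<open>W\<close>, bracketed the way the product rule for \<open>**\<close> delivers them.\<close>

definition "W x = matrix_inv (S x)"
definition "W1 r x = - (W x ** C r x ** W x)"
definition "W2 s r x = - (W x ** C r x ** W1 s x + (W x ** C2 s r x + W1 s x ** C r x) ** W x)"

lemma has_partial_W: "x \<in> T \<Longrightarrow> has_partial r W x (W1 r x)"
  unfolding W_def[abs_def] W1_def
  by (rule has_partial_matrix_inv[OF T _ inv S1]) auto

lemma has_partial_W1: "x \<in> T \<Longrightarrow> has_partial s (W1 r) x (W2 s r x)"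
proof -
  assume "x \<in> T"
  then have "has_partial s (\<lambda>x. - (W x ** C r x ** W x)) x (W2 s r x)"
    unfolding W2_def by (intro has_partial_minus has_partial_matrix_mult has_partial_W S2)
  then show ?thesis by (simp add: W1_def[abs_def])
qed

lemma has_partial_W2: "x \<in> T \<Longrightarrow> \<exists>D. has_partial t (W2 s r) x D"
  unfolding W2_def[abs_def]
  by (rule exI) (rule has_partial_minus has_partial_add has_partial_matrix_mult has_partial_W
      has_partial_W1 S2 S3 | assumption)+

text \<open>Kept abstract: existence is enough, as this term drops out of the mean of
  \<open>U3\<close>.\<close>

definition "W3 t s r = partial_deriv t (W2 s r)"

lemma has_partial_W2': "x \<in> T \<Longrightarrow> has_partial t (W2 s r) x (W3 t s r x)"
  using has_partial_W2 has_partial_imp_partial_deriv unfolding W3_def by metis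

text \<open>Transposition is linear and so commutes with differentiation; uniqueness of the
  derivative does the rest.\<close>

lemma sym_derivative:
  assumes "x \<in> T" "\<And>x. x \<in> T \<Longrightarrow> transpose (f x) = f x" "has_partial r f x (D :: real^'k::finite^'k)"
  shows "transpose D = D"
proof -
  have "bounded_linear (transpose :: real^'k^'k \<Rightarrow> _)"
    unfolding linear_conv_bounded_linear[symmetric] linear_iff by (simp add: transpose_def vec_eq_iff)
  then have "has_partial r (\<lambda>x. transpose (f x)) x (transpose D)"
    using assms(3) by (rule bounded_linear.has_partial)
  then have "has_partial r f x (transpose D)"
    by (rule has_partial_cong[OF T assms(1), rotated]) (rule assms(2))
  with assms(3) show ?thesis using has_partial_imp_partial_deriv by metis
qed

lemma sym_C: "x \<in> T \<Longrightarrow> transpose (C r x) = C r x"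
  by (rule sym_derivative[OF _ sym S1])

lemma sym_W: "x \<in> T \<Longrightarrow> transpose (W x) = W x"
  unfolding W_def using transpose_matrix_inv inv sym by metis

lemma sym_W1: "x \<in> T \<Longrightarrow> transpose (W1 r x) = W1 r x"
  by (rule sym_derivative[OF _ sym_W has_partial_W])

lemma sym_W2: "x \<in> T \<Longrightarrow> transpose (W2 s r x) = W2 s r x"
  by (rule sym_derivative[OF _ sym_W1 has_partial_W1])

lemma W_S: "x \<in> T \<Longrightarrow> W x ** S x = mat 1" and S_W: "x \<in> T \<Longrightarrow> S x ** W x = mat 1"
  by (simp_all add: W_def matrix_inv_inverse inv)

lemma W1_S: "x \<in> T \<Longrightarrow> W1 r x ** S x = - (W x ** C r x)"
  by (simp add: W1_def W_S matrix_mult_minus_left flip: matrix_mul_assoc)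

text \<open>By \<open>W1_S\<close>, \<open>c1 r x\<close> is \<open>- (1/2) * tr (W C\<^sub>r)\<close>, written so that it cancels
  the mean of the quadratic part of the score.\<close>

definition "c1 r x = (1/2) * trace (W1 r x ** S x)"
definition "b1 r x = W x *v a r x"
definition "c2 s r x = (1/2) * trace (W1 r x ** C s x + W2 s r x ** S x) - b1 r x \<bullet> a s x"
text \<open>\<open>b2'\<close> is the derivative of \<open>b1\<close> alone; \<open>b2\<close> adds
  the contribution of the residual. In \<open>c2\<close> and \<open>c3\<close> the last subtracted
  product has the same origin.\<close>

definition "b2' s r x = W x *v a2 s r x + W1 s x *v a r x"
definition "b2 s r x = b2' s r x + W1 r x *v a s x"
definition "c3 t s r x = (1/2) * trace (W1 r x ** C2 t s x + W2 t r x ** C s x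
    + (W2 s r x ** C t x + W3 t s r x ** S x))
  - (b1 r x \<bullet> a2 t s x + b2' t r x \<bullet> a s x) - b2 s r x \<bullet> a t x"

lemma loglik_lin_quad: "loglik m S y x = lin_quad (- (1/2) * ln (det (S x))) 0 (W x) (y - m x)"
  by (simp add: loglik_def lin_quad_def W_def trace_outer)

lemma U1_has_partial:
  assumes x: "x \<in> T"
  shows "has_partial r (loglik m S y) x (lin_quad (c1 r x) (b1 r x) (W1 r x) (y - m x))"
proof -
  have "has_partial r (\<lambda>x. lin_quad (- (1/2) * ln (det (S x))) 0 (W x) (y - m x)) x
    (lin_quad (- (1/2) * trace (matrix_inv (S x) ** C r x) - 0 \<bullet> a r x) (0 + W x *v a r x)
      (W1 r x) (y - m x))"
    by (intro has_partial_lin_quad has_partial_cmult has_partial_ln_det has_partial_const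
        has_partial_W S1 m1 inv sym_W x)
  moreover have "- (1/2) * trace (matrix_inv (S x) ** C r x) = c1 r x"
    using W1_S[OF x] by (simp add: c1_def W_def trace_def sum_negf)
  ultimately show ?thesis
    by (simp add: loglik_lin_quad[abs_def] b1_def)
qed

lemma U1_eq: "x \<in> T \<Longrightarrow> U1 m S r y x = lin_quad (c1 r x) (b1 r x) (W1 r x) (y - m x)"
  unfolding U1_def by (rule has_partial_imp_partial_deriv[OF U1_has_partial])

lemma has_partial_b1: "x \<in> T \<Longrightarrow> has_partial s (b1 r) x (b2' s r x)"
  unfolding b1_def[abs_def] b2'_def by (intro has_partial_matrix_vector_mult has_partial_W m2)

lemma has_partial_c1:
  "x \<in> T \<Longrightarrow> has_partial s (c1 r) x ((1/2) * trace (W1 r x ** C s x + W2 s r x ** S x))"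
  unfolding c1_def[abs_def]
  by (intro has_partial_cmult has_partial_trace has_partial_matrix_mult has_partial_W1 S1)

lemma has_partial_U1:
  assumes x: "x \<in> T"
  shows "has_partial s (\<lambda>x. lin_quad (c1 r x) (b1 r x) (W1 r x) (y - m x)) x
    (lin_quad (c2 s r x) (b2 s r x) (W2 s r x) (y - m x))"
  unfolding c2_def b2_def
  by (intro has_partial_lin_quad has_partial_c1 has_partial_b1 has_partial_W1 m1 sym_W1 x)

lemma U2_eq:
  assumes x: "x \<in> T"
  shows "U2 m S s r y x = lin_quad (c2 s r x) (b2 s r x) (W2 s r x) (y - m x)"
  unfolding U2_def
  by (rule partial_deriv_cong[OF T x _ has_partial_U1[OF x]]) (use U1_eq in \<open>simp add: U1_def\<close>)

lemma has_partial_b2: "x \<in> T \<Longrightarrow> \<exists>D. has_partial t (b2 s r) x D"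
  unfolding b2_def[abs_def] b2'_def
  by (rule exI) (rule has_partial_add has_partial_matrix_vector_mult has_partial_W
      has_partial_W1 m1 m2 m3 | assumption)+

lemma has_partial_c2:
  "x \<in> T \<Longrightarrow> has_partial t (c2 s r) x
    ((1/2) * trace (W1 r x ** C2 t s x + W2 t r x ** C s x + (W2 s r x ** C t x + W3 t s r x ** S x))
      - (b1 r x \<bullet> a2 t s x + b2' t r x \<bullet> a s x))"
  unfolding c2_def[abs_def]
  by (intro has_partial_diff has_partial_cmult has_partial_inner has_partial_trace has_partial_add
      has_partial_matrix_mult has_partial_W1 has_partial_W2' has_partial_b1 S1 S2 m1 m2)

text \<open>The linear coefficient stays existential but is uniform in \<open>y\<close>; it
  contributes nothing to the mean.\<close>

lemma U3_eq:
  assumes x: "x \<in> T"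
  shows "\<exists>b. \<forall>y. U3 m S t s r y x = lin_quad (c3 t s r x) b (W3 t s r x) (y - m x)"
proof -
  obtain b where b: "has_partial t (b2 s r) x b" using has_partial_b2[OF x] by blast
  have "has_partial t (\<lambda>x. lin_quad (c2 s r x) (b2 s r x) (W2 s r x) (y - m x)) x
    (lin_quad (c3 t s r x) (b + W2 s r x *v a t x) (W3 t s r x) (y - m x))" for y
    unfolding c3_def
    by (intro has_partial_lin_quad has_partial_c2 has_partial_W2' b m1 sym_W2 x)
  then show ?thesis
    unfolding U3_def
    by (intro exI allI partial_deriv_cong[OF T x]) (use U2_eq in \<open>auto simp add: U2_def\<close>)
qed

end

section \<open>The closed form of the bias\<close>

text \<open>Inversion block by block. On \<open>vec_cols X\<close> the lower blocks act as
  \<open>X \<mapsto> W X W\<close> and \<open>X \<mapsto> S X S\<close>, up to reciprocal scalars,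
  and these undo each other.\<close>

lemma H_mat_eq:
  fixes S :: "real^'p::finite \<Rightarrow> real^'m::finite^'m"
  assumes inv: "invertible (S x)" and sym: "transpose (S x) = S x"
  shows "H_mat S x = block_diag2 (matrix_inv (S x))
    ((1/2) *\<^sub>R kron (matrix_inv (S x)) (matrix_inv (S x)))"
  unfolding H_mat_def
proof (rule matrix_inv_eqI, unfold matrix_eq, rule allI)
  fix v :: "real^('m + 'm \<times> 'm)"
  let ?W = "matrix_inv (S x)"
  have symW: "transpose ?W = ?W" using transpose_matrix_inv inv sym by metis
  obtain a X where v: "v = append_vec a (vec_cols X)" by (rule append_vec_cases)
  have "S x ** (?W ** X ** ?W) ** S x = (S x ** ?W) ** X ** (?W ** S x)"
    by (simp add: matrix_mul_assoc)
  then have "S x ** (?W ** X ** ?W) ** S x = X"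
    by (simp add: matrix_inv_inverse inv)
  then show "(block_diag2 (S x) (2 *\<^sub>R kron (S x) (S x)) **
      block_diag2 ?W ((1/2) *\<^sub>R kron ?W ?W)) *v v = mat 1 *v v"
    by (simp add: v block_diag2_mult_append_vec kron_mult_vec_cols sym symW
        scaleR_matrix_vector_assoc[symmetric] matrix_vector_mult_scaleR matrix_inv_inverse inv
        flip: matrix_vector_mul_assoc)
      (simp add: matrix_vector_mul_assoc matrix_inv_inverse inv)
qed

lemma F_mat_eq: "F_mat m S x =
    of_cols (\<lambda>r. append_vec (partial_deriv r m x) (vec_cols (partial_deriv r S x)))"
  by (auto simp: vec_eq_iff F_mat_def D_mat_def V_mat_def append_rows_def of_cols_def
      append_vec_def split: sum.split)

text \<open>Column \<open>s\<close> of \<open>(I \<otimes> a\<^sub>r) D\<close> is the vectorisation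
  of the rank-one matrix \<open>outer a\<^sub>r a\<^sub>s\<close>, so the columns have the same
  stacked form as those of \<open>F_mat\<close>.\<close>

lemma Phi_mat_eq: "Phi_mat m S x r = of_cols (\<lambda>s. append_vec
      ((-1/2) *\<^sub>R partial_deriv s (partial_deriv r m) x)
      (vec_cols ((-1/2) *\<^sub>R (partial_deriv s (partial_deriv r S) x
        + 2 *\<^sub>R outer (partial_deriv r m x) (partial_deriv s m x)))))"
  by (auto simp: vec_eq_iff Phi_mat_def G_mat_def J_mat_def D_mat_def append_rows_def of_cols_def
      append_vec_def vec_cols_def outer_def kron_vec_def matrix_matrix_mult_def mat_def
      if_distrib if_distribR algebra_simps cong: if_cong split: sum.split)

context gaussian_family
begin

section \<open>Cumulants of the log-likelihood derivatives\<close>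

lemma S_b1: "x \<in> T \<Longrightarrow> S x *v b1 r x = a r x"
  by (simp add: b1_def matrix_vector_mul_assoc S_W)

lemma c1_centred: "c1 r x - (1/2) * trace (W1 r x ** S x) = 0"
  by (simp add: c1_def)

context
  fixes x and M :: "'w measure" and y :: "'w \<Rightarrow> real^'m"
  assumes x: "x \<in> T" and G: "centred_gaussian M (\<lambda>\<omega>. y \<omega> - m x) (S x)"
begin

text \<open>The score is centred by \<open>c1_centred\<close>, so only the two covariance terms of
  \<open>lin_quad_product\<close> remain.\<close>

lemma expectation_U1_U1:
  "(\<integral>\<omega>. U1 m S s (y \<omega>) x * U1 m S r (y \<omega>) x \<partial>M)
    = a s x \<bullet> (W x *v a r x) + (1/2) * trace (W x ** C s x ** W x ** C r x)"
proof -
  have "W1 s x ** S x ** W1 r x ** S x = (W1 s x ** S x) ** (W1 r x ** S x)"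
    by (simp add: matrix_mul_assoc)
  also have "\<dots> = W x ** C s x ** W x ** C r x"
    by (simp add: W1_S x matrix_mult_minus_left matrix_mult_minus_right matrix_mul_assoc)
  finally have "trace (W1 s x ** S x ** W1 r x ** S x) = trace (W x ** C s x ** W x ** C r x)"
    by simp
  moreover have "b1 s x \<bullet> (S x *v b1 r x) = a s x \<bullet> (W x *v a r x)"
    unfolding S_b1[OF x] using inner_symmetric_matrix[OF sym_W[OF x]]
    by (simp add: b1_def inner_commute)
  ultimately show ?thesis
    using has_bochner_integral_integral_eq[OF lin_quad_product[OF G sym_W1[OF x, of r],
      of "c1 s x" "b1 s x" "W1 s x" "c1 r x" "b1 r x"]]
    unfolding U1_eq[OF x] c1_centred by simp
qed

lemma expectation_U2_U1:
  "(\<integral>\<omega>. U2 m S t s (y \<omega>) x * U1 m S r (y \<omega>) x \<partial>M)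
    = b2 t s x \<bullet> a r x - (1/2) * trace (W2 t s x ** C r x)"
proof -
  have "W2 t s x ** S x ** W1 r x ** S x = W2 t s x ** S x ** (W1 r x ** S x)"
    by (simp add: matrix_mul_assoc)
  also have "\<dots> = - (W2 t s x ** (S x ** W x) ** C r x)"
    by (simp add: W1_S x matrix_mult_minus_left matrix_mult_minus_right matrix_mul_assoc)
  finally have "trace (W2 t s x ** S x ** W1 r x ** S x) = - trace (W2 t s x ** C r x)"
    by (simp add: S_W x trace_def sum_negf)
  then show ?thesis
    using has_bochner_integral_integral_eq[OF lin_quad_product[OF G sym_W1[OF x, of r],
      of "c2 t s x" "b2 t s x" "W2 t s x" "c1 r x" "b1 r x"]]
    unfolding U1_eq[OF x] U2_eq[OF x] c1_centred by (simp add: S_b1 x)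
qed

lemma expectation_U3:
  "(\<integral>\<omega>. U3 m S t s r (y \<omega>) x \<partial>M)
    = (1/2) * (trace (W1 r x ** C2 t s x) + trace (W2 t r x ** C s x) + trace (W2 s r x ** C t x))
      - b1 r x \<bullet> a2 t s x - b2' t r x \<bullet> a s x - b2 s r x \<bullet> a t x"
proof -
  obtain b where b: "\<And>y. U3 m S t s r y x = lin_quad (c3 t s r x) b (W3 t s r x) (y - m x)"
    using U3_eq[OF x] by blast
  \<comment> \<open>The \<open>W3\<close> term inside \<open>c3\<close> is exactly the mean of the
    quadratic part, so it cancels.\<close>
  have "c3 t s r x - (1/2) * trace (W3 t s r x ** S x)
    = (1/2) * (trace (W1 r x ** C2 t s x) + trace (W2 t r x ** C s x) + trace (W2 s r x ** C t x))
      - b1 r x \<bullet> a2 t s x - b2' t r x \<bullet> a s x - b2 s r x \<bullet> a t x"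
    by (simp add: c3_def trace_add field_simps)
  then show ?thesis
    using has_bochner_integral_integral_eq[OF lin_quad_mean[OF G, of "c3 t s r x" b "W3 t s r x"]]
    unfolding b by simp
qed

end

section \<open>Trace identities\<close>

abbreviation "X3 i j k x \<equiv> trace (W x ** C i x ** W x ** C j x ** W x ** C k x)"
abbreviation "X2 B k x \<equiv> trace (W x ** B ** W x ** C k x)"

lemma X3_cyclic: "X3 i j k x = X3 j k i x"
proof -
  have "X3 i j k x = trace ((W x ** C i x) ** (W x ** C j x ** W x ** C k x))"
    by (simp add: matrix_mul_assoc)
  also have "\<dots> = trace ((W x ** C j x ** W x ** C k x) ** (W x ** C i x))"
    by (rule trace_mul_sym)
  finally show ?thesis by (simp add: matrix_mul_assoc)
qed

lemma trace_W1_C2: "trace (W1 r x ** C2 t s x) = - X2 (C2 t s x) r x"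
proof -
  have "trace (W1 r x ** C2 t s x) = - trace ((W x ** C r x) ** (W x ** C2 t s x))"
    by (simp add: W1_def matrix_mult_minus_left matrix_mul_assoc trace_def sum_negf)
  also have "\<dots> = - trace ((W x ** C2 t s x) ** (W x ** C r x))"
    by (rule arg_cong[OF trace_mul_sym])
  finally show ?thesis by (simp add: matrix_mul_assoc)
qed

lemma trace_W2_C: "trace (W2 s r x ** C t x) = X3 r s t x + X3 s r t x - X2 (C2 s r x) t x"
proof -
  have "W2 s r x ** C t x = W x ** C r x ** W x ** C s x ** W x ** C t x
      + W x ** C s x ** W x ** C r x ** W x ** C t x - W x ** C2 s r x ** W x ** C t x"
    by (simp add: W2_def W1_def matrix_mult_minus_left matrix_mult_minus_right
        matrix_mult_add_left matrix_mult_diff_left matrix_mul_assoc)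
  then show ?thesis by (simp add: trace_add trace_sub)
qed

section \<open>Entries of \<open>F\<^sup>T H F\<close> and
  \<open>F\<^sup>T H \<Phi>\<^sub>r\<close>\<close>

definition "block_col r x = append_vec (a r x) (vec_cols (C r x))"
definition "Phi_col r s x = append_vec ((-1/2) *\<^sub>R a2 s r x)
  (vec_cols ((-1/2) *\<^sub>R (C2 s r x + 2 *\<^sub>R outer (a r x) (a s x))))"

lemma F_eq: "F_mat m S x = of_cols (\<lambda>r. block_col r x)"
  by (simp add: F_mat_eq block_col_def)

lemma Phi_eq: "Phi_mat m S x r = of_cols (\<lambda>s. Phi_col r s x)"
  by (simp add: Phi_mat_eq Phi_col_def)

text \<open>The lower block contributes half the trace of \<open>C\<^sub>t W B W\<close>, rotated
  cyclically into \<open>X2\<close>.\<close>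

lemma block_col_H:
  assumes x: "x \<in> T"
  shows "block_col t x \<bullet> (H_mat S x *v append_vec v (vec_cols B))
    = a t x \<bullet> (W x *v v) + (1/2) * X2 B t x"
proof -
  have "trace (C t x ** (W x ** B ** W x)) = trace ((W x ** B ** W x) ** C t x)"
    by (rule trace_mul_sym)
  then show ?thesis
    using sym_W[OF x] sym_C[OF x, of t]
    by (simp add: H_mat_eq inv sym x block_col_def block_diag2_mult_append_vec append_vec_inner
        kron_mult_vec_cols vec_cols_inner scaleR_matrix_vector_assoc[symmetric] flip: W_def)
qed

text \<open>Arranged to agree with \<open>expectation_U1_U1\<close>, which identifies
  \<open>F\<^sup>T H F\<close> with the Fisher information.\<close>

lemma block_col_H_block_col:
  assumes x: "x \<in> T"
  shows "block_col s x \<bullet> (H_mat S x *v block_col r x)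
    = a s x \<bullet> (W x *v a r x) + (1/2) * X2 (C s x) r x"
proof -
  have "X2 (C r x) s x = trace ((W x ** C r x) ** (W x ** C s x))"
    by (simp add: matrix_mul_assoc)
  also have "\<dots> = trace ((W x ** C s x) ** (W x ** C r x))"
    by (rule trace_mul_sym)
  finally show ?thesis
    using block_col_H[OF x, of s "a r x" "C r x"]
    by (simp add: block_col_def matrix_mul_assoc)
qed

text \<open>A trace against a rank-one matrix is a bilinear form, and \<open>W C\<^sub>t W\<close>
  is \<open>- W1 t\<close>. This turns the contribution of \<open>J_mat\<close> into terms of the
  kind found in the cumulants.\<close>

lemma X2_outer: "X2 (outer u v) t x = - (v \<bullet> (W1 t x *v u))"
proof -
  have "X2 (outer u v) t x = trace ((W x ** outer u v) ** (W x ** C t x))"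
    by (simp add: matrix_mul_assoc)
  also have "\<dots> = trace ((W x ** C t x) ** (W x ** outer u v))"
    by (rule trace_mul_sym)
  also have "\<dots> = trace ((W x ** C t x ** W x) ** outer u v)"
    by (simp add: matrix_mul_assoc)
  finally show ?thesis
    by (simp add: trace_outer W1_def inner_vec_def matrix_vector_mult_def sum_negf)
qed

lemma X2_linear: "X2 (c *\<^sub>R (A + d *\<^sub>R B)) t x = c * (X2 A t x + d * X2 B t x)"
proof -
  have "bounded_linear (\<lambda>A. X2 A t x)"
    by (intro bounded_linear_compose[OF bounded_linear_trace]
        bounded_linear_compose[OF bounded_bilinear.bounded_linear_left[OF bounded_bilinear_matrix_mult]]
        bounded_bilinear.bounded_linear_right[OF bounded_bilinear_matrix_mult])
  then have l: "linear (\<lambda>A. X2 A t x)" by (rule bounded_linear.linear)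
  show ?thesis
    using linear_add[OF l, of A "d *\<^sub>R B"] linear_scale[OF l, of c "A + d *\<^sub>R B"]
      linear_scale[OF l, of d B] by simp
qed

lemma block_col_H_Phi_col:
  assumes x: "x \<in> T"
  shows "block_col t x \<bullet> (H_mat S x *v Phi_col r s x)
    = - (1/2) * (a t x \<bullet> (W x *v a2 s r x)) - (1/4) * X2 (C2 s r x) t x
      + (1/2) * (a s x \<bullet> (W1 t x *v a r x))"
  unfolding Phi_col_def block_col_H[OF x] X2_linear X2_outer matrix_vector_mult_scaleR
    inner_scaleR_right
  by (simp add: algebra_simps)

text \<open>The cubic traces \<open>X3\<close> cancel within each order of \<open>s\<close> and
  \<open>r\<close> by cyclicity. The terms in \<open>a2 t s\<close> and \<open>a2 t r\<close>, in
  \<open>C2 t s\<close> and \<open>C2 t r\<close>, and in \<open>W1 s\<close> and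
  \<open>W1 r\<close> are antisymmetric under exchange of \<open>s\<close> and \<open>r\<close>, so
  they vanish in the sum. What is left is \<open>g\<close>.\<close>

lemma symmetrized_bias_terms:
  fixes t s r :: 'p
  assumes x: "x \<in> T"
  defines "k3 \<equiv> \<lambda>s r. (1/2) * (trace (W1 r x ** C2 t s x) + trace (W2 t r x ** C s x)
        + trace (W2 s r x ** C t x))
      - b1 r x \<bullet> a2 t s x - b2' t r x \<bullet> a s x - b2 s r x \<bullet> a t x"
    and "k21 \<equiv> \<lambda>s r. b2 t s x \<bullet> a r x - (1/2) * trace (W2 t s x ** C r x)"
    and "g \<equiv> \<lambda>s r. block_col t x \<bullet> (H_mat S x *v Phi_col r s x)"
  shows "((1/2) * k3 s r + k21 s r) + ((1/2) * k3 r s + k21 r s) = g s r + g r s"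
proof -
  have w: "v \<bullet> (W x *v u) = u \<bullet> (W x *v v)" for u v
    by (rule inner_symmetric_matrix[OF sym_W[OF x]])
  have w1: "v \<bullet> (W1 i x *v u) = u \<bullet> (W1 i x *v v)" for u v i
    by (rule inner_symmetric_matrix[OF sym_W1[OF x]])
  have dots: "b1 i x \<bullet> u = u \<bullet> (W x *v a i x)"
    "b2' i j x \<bullet> u = u \<bullet> (W x *v a2 i j x) + u \<bullet> (W1 i x *v a j x)"
    "b2 i j x \<bullet> u = u \<bullet> (W x *v a2 i j x) + u \<bullet> (W1 i x *v a j x) + u \<bullet> (W1 j x *v a i x)"
    for i j u
    by (simp_all add: b1_def b2'_def b2_def inner_simps inner_commute)
  show ?thesis
    unfolding k3_def k21_def g_def block_col_H_Phi_col[OF x] trace_W1_C2 trace_W2_C dots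
    using X3_cyclic[of x t s r] X3_cyclic[of x s r t] X3_cyclic[of x t r s] X3_cyclic[of x r s t]
      w[of "a r x" "a2 t s x"] w[of "a s x" "a2 t r x"]
      w1[of "a r x" s "a t x"] w1[of "a s x" r "a t x"] w1[of "a r x" t "a s x"]
      w1[of "a r x" r "a t x"] w1[of "a s x" s "a t x"] w1[of "a r x" s "a s x"]
    by (simp add: field_simps)
qed

lemma cox_snell_bias_closed_form:
  fixes P :: "real^'p \<Rightarrow> 'w measure"
  assumes x: "x \<in> T" and G: "centred_gaussian (P x) (\<lambda>\<omega>. y \<omega> - m x) (S x)"
    and K_inv: "invertible (fisher_information P y m S x)"
  shows "cox_snell_bias P y m S x
    = (matrix_inv (transpose (F_mat m S x) ** H_mat S x ** F_mat m S x)
        ** transpose (F_mat m S x) ** H_mat S x) *v xi_vec m S x"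
proof -
  let ?F = "F_mat m S x" and ?H = "H_mat S x"
  define K where "K = fisher_information P y m S x"
  define k where "k = matrix_inv K"
  have K: "transpose ?F ** ?H ** ?F = K"
    by (simp add: K_def vec_eq_iff F_eq of_cols_congruence_entry block_col_H_block_col[OF x]
        fisher_information_def expectation_U1_U1[OF x G])
  have "transpose K = K"
    by (simp add: K_def fisher_information_def transpose_def vec_eq_iff mult.commute)
  then have k_sym: "transpose k = k"
    using K_inv transpose_matrix_inv unfolding k_def K_def by metis
  have xi: "xi_vec m S x = (\<Sum>r\<in>UNIV. \<Sum>s\<in>UNIV. k $ s $ r *\<^sub>R Phi_col r s x)"
    unfolding xi_vec_def K k_def[symmetric] by (rule concat_cols_mult_vec_cols) (rule Phi_eq)
  \<comment> \<open>Entry \<open>t\<close> of \<open>F\<^sup>T H \<xi>\<close> is the inner double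
    sum of the Cox-Snell formula, before multiplication by the inverse information.\<close>
  have F_xi: "block_col t x \<bullet> (?H *v xi_vec m S x)
    = (\<Sum>s\<in>UNIV. \<Sum>r\<in>UNIV. k $ s $ r *
        ((1/2) * kappa3 P y m S x t s r + kappa21 P y m S x t s r))" for t
  proof -
    have "block_col t x \<bullet> (?H *v xi_vec m S x)
        = (\<Sum>r\<in>UNIV. \<Sum>s\<in>UNIV. k $ s $ r * (block_col t x \<bullet> (?H *v Phi_col r s x)))"
      unfolding xi
      by (simp add: linear_sum[OF matrix_vector_mul_linear] inner_sum_right matrix_vector_mult_scaleR)
    also have "\<dots> = (\<Sum>s\<in>UNIV. \<Sum>r\<in>UNIV. k $ s $ r * (block_col t x \<bullet> (?H *v Phi_col r s x)))"
      by (rule sum.swap)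
    also have "\<dots> = (\<Sum>s\<in>UNIV. \<Sum>r\<in>UNIV. k $ s $ r *
        ((1/2) * kappa3 P y m S x t s r + kappa21 P y m S x t s r))"
      unfolding kappa3_def kappa21_def expectation_U3[OF x G] expectation_U2_U1[OF x G]
      by (rule sum_symmetric_weights[OF k_sym symmetrized_bias_terms[OF x, symmetric]])
    finally show ?thesis .
  qed
  have "(k ** transpose ?F ** ?H) *v xi_vec m S x = k *v (transpose ?F *v (?H *v xi_vec m S x))"
    by (simp add: matrix_vector_mul_assoc matrix_mul_assoc)
  also have "transpose ?F *v (?H *v xi_vec m S x) = (\<chi> t. \<Sum>s\<in>UNIV. \<Sum>r\<in>UNIV. k $ s $ r *
      ((1/2) * kappa3 P y m S x t s r + kappa21 P y m S x t s r))"
    by (simp only: F_eq transpose_of_cols_mult F_xi)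
  also have "k *v \<dots> = cox_snell_bias P y m S x"
    by (simp add: cox_snell_bias_def Let_def vec_eq_iff matrix_vector_mult_def sum_distrib_left
        mult.assoc flip: K_def k_def)
  finally show ?thesis by (simp add: K k_def)
qed

end

section \<open>Smoothness\<close>

text \<open>Collects the iterated partial derivatives that \<open>gaussian_family\<close> asks for,
  in a form that also covers vector and matrix values and can be checked entrywise.\<close>

primrec partially_diff ::
  "nat \<Rightarrow> (real^'p::finite \<Rightarrow> 'b::real_normed_vector) \<Rightarrow> (real^'p) set \<Rightarrow> bool"
  where
    "partially_diff 0 f T \<longleftrightarrow> True"
  | "partially_diff (Suc k) f T \<longleftrightarrow> (\<forall>r. (\<forall>x\<in>T. has_partial r f x (partial_deriv r f x))
       \<and> partially_diff k (partial_deriv r f) T)"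

lemma partially_diff_const: "partially_diff k (\<lambda>_ :: real^'p::finite. c) T"
proof (induction k arbitrary: c)
  case (Suc k)
  have "partial_deriv r (\<lambda>_ :: real^'p. c) = (\<lambda>_. 0)" for r
    by (rule ext) (rule has_partial_imp_partial_deriv[OF has_partial_const])
  then show ?case using Suc.IH[of 0] by (simp add: has_partial_const)
qed simp

text \<open>On an open set equal functions have equal partial derivatives, so the induction
  hypothesis applies to these.\<close>

lemma partially_diff_cong:
  assumes "open T" "\<And>x. x \<in> T \<Longrightarrow> f x = g x" "partially_diff k f T"
  shows "partially_diff k g T"
  using assms(2,3)
proof (induction k arbitrary: f g)
  case (Suc k)
  have part: "has_partial r g x (partial_deriv r f x)" if "x \<in> T" for r x
    using has_partial_cong[OF assms(1) that Suc.prems(1)] Suc.prems(2) that by simp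
  then have eq: "partial_deriv r f x = partial_deriv r g x" if "x \<in> T" for r x
    using has_partial_imp_partial_deriv that by metis
  have "partially_diff k (partial_deriv r g) T" for r
    by (rule Suc.IH[of "partial_deriv r f"]) (use eq Suc.prems(2) in auto)
  then show ?case using part eq by simp
qed simp

lemma partially_diff_vec:
  fixes f :: "real^'p::finite \<Rightarrow> 'b::real_normed_vector^'a::finite"
  assumes "open T" "\<And>i. partially_diff k (\<lambda>x. f x $ i) T"
  shows "partially_diff k f T"
  using assms(2)
proof (induction k arbitrary: f)
  case (Suc k)
  have part: "has_partial r f x (\<chi> i. partial_deriv r (\<lambda>x. f x $ i) x)" if "x \<in> T" for r x
    using Suc.prems that by (intro has_partial_vec) simp
  then have eq: "partial_deriv r f x = (\<chi> i. partial_deriv r (\<lambda>x. f x $ i) x)"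
    if "x \<in> T" for r x
    using has_partial_imp_partial_deriv that by metis
  have "partially_diff k (partial_deriv r f) T" for r
  proof (rule Suc.IH)
    show "partially_diff k (\<lambda>x. partial_deriv r f x $ i) T" for i
      by (rule partially_diff_cong[OF assms(1), of "partial_deriv r (\<lambda>x. f x $ i)"])
        (use eq Suc.prems in auto)
  qed
  then show ?case using part eq by simp
qed simp

lemma continuously_diff_imp_partially_diff:
  "continuously_diff k f T \<Longrightarrow> partially_diff k f T"
proof (induction k arbitrary: f)
  case (Suc k)
  have "has_partial r f x (partial_deriv r f x)" if "x \<in> T" for r x
  proof -
    \<comment> \<open>The base point is written as the value at 0 of the coordinate line, the form
      the chain rule expects.\<close>
    have "f differentiable (at (x + 0 *\<^sub>R axis r (1::real)))" using Suc.prems that by simp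
    moreover have "(\<lambda>t. x + t *\<^sub>R axis r (1::real)) differentiable (at 0)"
      by simp
    ultimately have "(f \<circ> (\<lambda>t. x + t *\<^sub>R axis r (1::real))) differentiable (at 0)"
      by (intro differentiable_chain_at)
    then show ?thesis
      by (simp add: has_partial_def partial_deriv_def vector_derivative_works comp_def)
  qed
  then show ?case using Suc by simp
qed simp

lemma gaussian_familyI:
  assumes "open T" "\<And>x. x \<in> T \<Longrightarrow> invertible (S x)" "\<And>x. x \<in> T \<Longrightarrow> transpose (S x) = S x"
    "partially_diff 3 m T" "partially_diff 3 S T"
  shows "gaussian_family T m S"
  using assms by unfold_locales (simp_all add: numeral_3_eq_3)

theorem mainTheorem1:
  fixes \<Theta> :: "(real^'p::finite) set"
    and \<mu> :: "'n::finite \<Rightarrow> real^'p \<Rightarrow> real^'q::finite"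
    and \<Sigma> :: "'n \<Rightarrow> real^'p \<Rightarrow> real^'q^'q"
    and P :: "real^'p \<Rightarrow> 'w measure"
    and Y :: "'n \<Rightarrow> 'w \<Rightarrow> real^'q"
    and \<theta> :: "real^'p"
  assumes "open \<Theta>"
    and "\<And>i j. continuously_diff 3 (\<lambda>\<theta>. \<mu> i \<theta> $ j) \<Theta>"
    and "\<And>i j k. continuously_diff 3 (\<lambda>\<theta>. \<Sigma> i \<theta> $ j $ k) \<Theta>"
    and "\<And>i \<theta>. \<theta> \<in> \<Theta> \<Longrightarrow> covariance_matrix (\<Sigma> i \<theta>)"
    and "\<And>i \<theta>. \<theta> \<in> \<Theta> \<Longrightarrow> invertible (\<Sigma> i \<theta>)"
    and "\<And>\<theta>. \<theta> \<in> \<Theta> \<Longrightarrow> prob_space (P \<theta>)"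
    and "\<And>\<theta>. \<theta> \<in> \<Theta> \<Longrightarrow> prob_space.indep_vars (P \<theta>) (\<lambda>_. borel) Y UNIV"
    and "\<And>i \<theta>. \<theta> \<in> \<Theta> \<Longrightarrow> distributed (P \<theta>) lborel (Y i) (mvn_density (\<mu> i \<theta>) (\<Sigma> i \<theta>))"
    and "\<theta> \<in> \<Theta>"
    and "invertible (fisher_information P (\<lambda>\<omega>. stack_vec (\<lambda>i. Y i \<omega>))
           (\<lambda>\<theta>. stack_vec (\<lambda>i. \<mu> i \<theta>)) (\<lambda>\<theta>. block_diag (\<lambda>i. \<Sigma> i \<theta>)) \<theta>)"
  shows "let m = (\<lambda>\<theta>. stack_vec (\<lambda>i. \<mu> i \<theta>));
             S = (\<lambda>\<theta>. block_diag (\<lambda>i. \<Sigma> i \<theta>));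
             F = F_mat m S \<theta>;
             H = H_mat S \<theta>
         in cox_snell_bias P (\<lambda>\<omega>. stack_vec (\<lambda>i. Y i \<omega>)) m S \<theta>
            = (matrix_inv (transpose F ** H ** F) ** transpose F ** H) *v xi_vec m S \<theta>"
proof -
  let ?m = "\<lambda>\<theta>. stack_vec (\<lambda>i. \<mu> i \<theta>)" and ?S = "\<lambda>\<theta>. block_diag (\<lambda>i. \<Sigma> i \<theta>)"
  have Sigma_sym: "transpose (\<Sigma> i x) = \<Sigma> i x" if "x \<in> \<Theta>" for i x
    using assms(4)[OF that] by (simp add: covariance_matrix_def)
  interpret gaussian_family \<Theta> ?m ?S
  proof (rule gaussian_familyI)
    show "open \<Theta>" by (rule assms)
    show "invertible (?S x)" if "x \<in> \<Theta>" for x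
      by (rule invertible_block_diag) (rule assms(5)[OF that])
    show "transpose (?S x) = ?S x" if "x \<in> \<Theta>" for x
      by (rule transpose_block_diag) (rule Sigma_sym[OF that])
    show "partially_diff 3 ?m \<Theta>"
      using assms(2)
      by (intro partially_diff_vec[OF assms(1)])
        (simp add: stack_vec_def continuously_diff_imp_partially_diff)
    \<comment> \<open>Entries outside the diagonal blocks are constantly 0; the others are entries
      of some \<open>\<Sigma> i\<close>.\<close>
    have "partially_diff 3 (\<lambda>x. ?S x $ k $ l) \<Theta>" for k l
      using assms(3) by (cases "fst k = fst l")
        (simp_all add: block_diag_def continuously_diff_imp_partially_diff partially_diff_const)
    then show "partially_diff 3 ?S \<Theta>"
      by (intro partially_diff_vec[OF assms(1)])
  qed
  have "centred_gaussian (P \<theta>) (\<lambda>\<omega>. stack_vec (\<lambda>i. Y i \<omega>) - ?m \<theta>) (?S \<theta>)"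
    using assms(9) by (intro stacked_gaussian assms Sigma_sym[OF assms(9)])
  from cox_snell_bias_closed_form[where P = P, OF assms(9) this assms(10)]
  show ?thesis unfolding Let_def .
qed

end
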